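(* Let $d\ge1$ be an integer, let $c$ be an indeterminate and let $\tilde f_c(z)=(z-c)z^d+c$. For every positive integer $m$, the polynomial $$d^{(d-1)\varepsilon_m+\deg_z\tilde\Phi_m^*/(d+1)}\;\tilde\delta_m(x)$$ is an element of $\mathbb{Z}[(dc)^d,x]$ and is monic in $(dc)^d$ up to multiplication by $\pm1$ (that is, viewed as a polynomial in $t=(dc)^d$ with coefficients in $\mathbb{Z}[x]$ its leading coefficient is $\pm1$). Here $\varepsilon_m=1$ if $m=1$ and $\varepsilon_m=0$ if $m\ne1$.
   Context: Regard $\tilde f_c$ as a polynomial in $z$ over $\mathbb{Z}[c]$; $\tilde f_c^{\circ k}$ is its $k$-th iterate and $\mu$ the Möbius function. The $m$-th dynatomic polynomial of $\tilde f_c$ is $\tilde\Phi_m^*(z)=\prod_{k\mid m}(\tilde f_c^{\circ k}(z)-z)^{\mu(m/k)}$. The $m$-th multiplier polynomial $\tilde\delta_m(x)\in\mathbb{Z}[c][x]$ is the monic polynomial in $x$ with $\tilde\delta_m(x)^m=\mathrm{Res}_z\left(\tilde\Phi_m^*(z),x-(\tilde f_c^{\circ m})'(z)\right)=\prod_{\tilde\Phi_m^*(\alpha)=0}\left(x-(\tilde f_c^{\circ m})'(\alpha)\right)$ (roots in $\overline{\mathbb{Q}(c)}$ with multiplicity). *)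

theory Defs
  imports
    "HOL-Computational_Algebra.Computational_Algebra"
    "Subresultants.Resultant_Prelim"
begin

text \<open>
  \<open>\<int>[c][z]\<close> and \<open>\<int>[c][x]\<close> are both rendered as \<^typ>\<open>int poly poly\<close>: the inner variable is \<open>c\<close>, the
  outer one \<open>z\<close> or \<open>x\<close>. \<open>\<int>[c][x][z]\<close> is \<^typ>\<open>int poly poly poly\<close>, with \<open>z\<close> outermost.
\<close>

definition moebius :: "nat \<Rightarrow> int" where
  "moebius n = (if squarefree n then (- 1) ^ card (prime_factors n) else 0)"

definition ftilde :: "nat \<Rightarrow> int poly poly" where
  "ftilde d = (let z = [:0, 1:]; c = [:[:0, 1:]:] in (z - c) * z ^ d + c)"

definition ftilde_iter :: "nat \<Rightarrow> nat \<Rightarrow> int poly poly" where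
  "ftilde_iter d k = (pcompose (ftilde d) ^^ k) [:0, 1:]"

text \<open>
  The product has negative exponents, so it is formed in the fraction field of \<open>\<int>[c][z]\<close>;
  \<open>dynatomic d m\<close> is the polynomial that it equals.
\<close>

definition dynatomic :: "nat \<Rightarrow> nat \<Rightarrow> int poly poly" where
  "dynatomic d m = (THE p. to_fract p =
     (\<Prod>k | k dvd m. to_fract (ftilde_iter d k - [:0, 1:]) powi moebius (m div k)))"

text \<open>
  \<open>Res\<^sub>z(\<Phi>(z), x - (f^m)'(z))\<close> in \<open>\<int>[c][x]\<close>. Mapping \<open>\<lambda>a. [:a:]\<close> over the coefficients embeds
  \<open>\<int>[c][z]\<close> in \<open>\<int>[c][x][z]\<close>; \<open>[:[:0, 1:]:]\<close> is \<open>x\<close>; \<^const>\<open>pderiv\<close> is the derivative in \<open>z\<close>.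
\<close>

definition multiplier_resultant :: "nat \<Rightarrow> nat \<Rightarrow> int poly poly" where
  "multiplier_resultant d m =
     resultant (map_poly (\<lambda>a. [:a:]) (dynatomic d m))
               ([:[:0, 1:]:] - map_poly (\<lambda>a. [:a:]) (pderiv (ftilde_iter d m)))"

definition multiplier_poly :: "nat \<Rightarrow> nat \<Rightarrow> int poly poly" where
  "multiplier_poly d m =
     (THE \<delta>. lead_coeff \<delta> = 1 \<and> \<delta> ^ m = multiplier_resultant d m)"

text \<open>
  Here \<open>Q\<close> is in \<open>\<int>[x][t]\<close> (inner variable \<open>x\<close>, outer variable \<open>t\<close>), and \<open>subst_t d Q\<close> in \<open>\<int>[c][x]\<close>
  (inner variable \<open>c\<close>) is the result of setting \<open>t = (d c)^d\<close>.
\<close>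

definition subst_t :: "nat \<Rightarrow> int poly poly \<Rightarrow> int poly poly" where
  "subst_t d Q =
     poly (map_poly (map_poly (\<lambda>a. [:a:])) Q) ([:[:0, of_nat d:]:] ^ d)"

end

theory Submission
  imports Defs
begin

text \<open>
  Write \<open>f(z) = (z - c) z\<^sup>d + c\<close>. The proof looks at complex parameters \<open>c\<close> of large modulus, where the
  cycles of \<open>f\<close> are almost explicit, and translates size and symmetry in \<open>c\<close> back into statements about
  integer polynomials, which are determined by their values at such \<open>c\<close>.

  Everything rests on the identity \<open>f(z) - c = z\<^sup>d (z - c)\<close>. Multiplied over a cycle that avoids the
  fixed point \<open>c\<close>, it says that the product of the points of the cycle is a root of unity
  (\<open>norm_prod_orbit\<close>). As \<open>f'(z) = z\<^bsup>d-1\<^esup> (z + d (z - c))\<close>, the modulus of the multiplier is the product of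
  the moduli of the factors \<open>z + d (z - c)\<close>. A periodic point lies within distance 4 of \<open>c\<close> or of \<open>0\<close>
  (\<open>fixpts_dichotomy\<close>); its factor is about \<open>c\<close> in the first case and about \<open>-dc\<close> in the second.

  Hence no multiplier is 1, every iterate has simple fixed points, and the \<open>m\<close>-th dynatomic polynomial
  specialises to the product of \<open>z - \<alpha>\<close> over the points \<open>\<alpha>\<close> of exact period \<open>m\<close> (\<open>dynatomic_spec\<close>, by
  Moebius inversion). Comparing the sum of the fixed points of \<open>f\<^sup>k\<close> with the second coefficient of \<open>f\<^sup>k\<close>
  shows that exactly one in \<open>d + 1\<close> of them is near \<open>c\<close>, and the same proportion holds for the points of
  exact period \<open>m\<close> (\<open>card_near_primpts\<close>). Let \<open>N\<close> be the number of
  points of exact period \<open>m\<close> near \<open>c\<close>, and let \<open>N' = N\<close>, except that \<open>N' = N + d - 1\<close> for \<open>m = 1\<close>,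
  because the fixed point \<open>c\<close> has multiplier \<open>c\<^sup>d\<close> instead of one of size \<open>c\<close>.

  The power of \<open>d\<close> comes from treating the \<open>d\<close> in the derivative as an independent variable \<open>D\<close>, while the
  map and its cycles stay the same. For \<open>D = s / c\<close> the factor \<open>z + D (z - c)\<close> has size \<open>c\<close> near \<open>c\<close> and
  is bounded near \<open>0\<close>, so the resultant is \<open>O(c\<^bsup>m N'\<^esup>)\<close>. Therefore the coefficient of \<open>D\<^sup>i\<close> has degree at
  most \<open>m N' + i\<close> in \<open>c\<close> (\<open>coeff_zero_if_weighted_growth\<close>), and at \<open>D = d\<close> the resultant multiplied by
  \<open>d\<^bsup>m N'\<^esup>\<close> becomes an integer polynomial in \<open>dc\<close> (\<open>exists_rescaled_resultant\<close>).

  The resultant is the \<open>m\<close>-th power of the multiplier polynomial since multipliers are constant on cycles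
  (\<open>multiplier_poly_spec\<close>), and factorial rings contain the roots of their elements that lie in the
  fraction field, so \<open>d\<^bsup>N'\<^esup>\<close> times the multiplier polynomial is an integer polynomial \<open>E\<close> in \<open>s = dc\<close> and
  \<open>x\<close> (\<open>exists_rescaled_root\<close>). The sizes of the factors give \<open>|E(s, x)| / |s|\<^sup>T \<rightarrow> 1\<close> for every \<open>x\<close>, so
  that the leading coefficient in \<open>s\<close> is an integer polynomial in \<open>x\<close> of constant modulus 1, which is
  \<open>\<plusminus>1\<close>. Finally \<open>z \<mapsto> \<zeta>z\<close> with \<open>\<zeta>\<^sup>d = 1\<close> conjugates the maps with parameters \<open>c\<close> and \<open>\<zeta>c\<close>, so that
  only powers of \<open>s\<^sup>d\<close> occur.
\<close>

section \<open>Periodic points\<close>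

definition fmap :: "nat \<Rightarrow> complex \<Rightarrow> complex \<Rightarrow> complex" where
  "fmap d c z = (z - c) * z ^ d + c"

text \<open>
  The derivative of \<open>fmap d c\<close> is the value at \<open>D = d\<close>; the separate \<open>D\<close> makes it possible to vary the
  factor \<open>d\<close> of the derivative while the map is kept.
\<close>

definition slope :: "nat \<Rightarrow> complex \<Rightarrow> complex \<Rightarrow> complex \<Rightarrow> complex" where
  "slope d c D z = z ^ (d - 1) * (z + D * (z - c))"

definition cycle_slope :: "nat \<Rightarrow> complex \<Rightarrow> complex \<Rightarrow> nat \<Rightarrow> complex \<Rightarrow> complex" where
  "cycle_slope d c D n z = (\<Prod>i<n. slope d c D ((fmap d c ^^ i) z))"

definition fixpts :: "nat \<Rightarrow> complex \<Rightarrow> nat \<Rightarrow> complex set" where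
  "fixpts d c n = {z. (fmap d c ^^ n) z = z}"

definition primpts :: "nat \<Rightarrow> complex \<Rightarrow> nat \<Rightarrow> complex set" where
  "primpts d c n = {z \<in> fixpts d c n. \<forall>k\<in>{0<..<n}. z \<notin> fixpts d c k}"

lemma funpow_mod_period:
  assumes "(f ^^ n) z = z" shows "(f ^^ (k mod n)) z = (f ^^ k) z"
proof -
  have "(f ^^ (n * q)) z = z" for q
    by (induction q) (simp_all add: funpow_add assms)
  then have "(f ^^ (k mod n + n * (k div n))) z = (f ^^ (k mod n)) z"
    by (simp only: funpow_add o_apply)
  then show ?thesis by simp
qed

lemma fixpts_mono: assumes "k dvd n" shows "fixpts d c k \<subseteq> fixpts d c n"
proof
  fix z assume "z \<in> fixpts d c k"
  then have "(fmap d c ^^ (n mod k)) z = (fmap d c ^^ n) z"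
    by (intro funpow_mod_period) (simp add: fixpts_def)
  then show "z \<in> fixpts d c n" using assms by (simp add: fixpts_def)
qed

lemma primpts_dvd:
  assumes "z \<in> primpts d c k" "z \<in> fixpts d c n" "k > 0" shows "k dvd n"
proof -
  have "(fmap d c ^^ (n mod k)) z = (fmap d c ^^ n) z"
    using assms by (intro funpow_mod_period) (simp add: fixpts_def primpts_def)
  then have "z \<in> fixpts d c (n mod k)" using assms by (simp add: fixpts_def)
  moreover have "n mod k < k" using assms by simp
  ultimately have "n mod k = 0" using assms(1) by (auto simp: primpts_def)
  then show ?thesis by auto
qed

lemma fixpts_Union_primpts:
  assumes "n > 0" shows "fixpts d c n = (\<Union>k\<in>{k. k dvd n}. primpts d c k)"
proof (intro equalityI subsetI)
  fix z assume z: "z \<in> fixpts d c n"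
  define k where "k = (LEAST k. k > 0 \<and> z \<in> fixpts d c k)"
  have k: "k > 0 \<and> z \<in> fixpts d c k"
    unfolding k_def by (rule LeastI[of _ n]) (use z assms in auto)
  have "z \<notin> fixpts d c j" if "0 < j" "j < k" for j
    using not_less_Least[OF that(2)[unfolded k_def]] that(1) by auto
  then have "z \<in> primpts d c k" using k by (auto simp: primpts_def)
  then show "z \<in> (\<Union>k\<in>{k. k dvd n}. primpts d c k)" using primpts_dvd z k by blast
next
  fix z assume "z \<in> (\<Union>k\<in>{k. k dvd n}. primpts d c k)"
  then obtain k where "k dvd n" "z \<in> primpts d c k" by blast
  then show "z \<in> fixpts d c n" using fixpts_mono[of k n d c] by (auto simp: primpts_def)
qed

lemma primpts_disjoint:
  assumes "j > 0" "k > 0" "j \<noteq> k" shows "primpts d c j \<inter> primpts d c k = {}"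
  using assms primpts_dvd[of _ d c j k] primpts_dvd[of _ d c k j]
  by (auto simp: primpts_def dest: dvd_antisym)

lemma funpow_fixpts:
  assumes "z \<in> fixpts d c n" shows "(fmap d c ^^ i) z \<in> fixpts d c n"
proof -
  have "(fmap d c ^^ (n + i)) z = (fmap d c ^^ (i + n)) z" by (simp only: add.commute)
  then show ?thesis using assms by (simp add: fixpts_def funpow_add)
qed

lemma fmap_inj_fixpts: assumes "n > 0" shows "inj_on (fmap d c ^^ i) (fixpts d c n)"
proof (rule inj_onI)
  fix z w assume z: "z \<in> fixpts d c n" and w: "w \<in> fixpts d c n"
    and eq: "(fmap d c ^^ i) z = (fmap d c ^^ i) w"
  have i: "i * n - i + i = i * n" using assms by (cases n) auto
  have *: "(fmap d c ^^ (i * n - i)) ((fmap d c ^^ i) u) = u" if "u \<in> fixpts d c n" for u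
  proof -
    have "(fmap d c ^^ (i * n - i)) ((fmap d c ^^ i) u) = (fmap d c ^^ (i * n)) u"
      using i by (metis comp_apply funpow_add)
    also have "\<dots> = u" using fixpts_mono[of n "i * n" d c] that by (auto simp: fixpts_def)
    finally show ?thesis .
  qed
  show "z = w" using *[OF z] *[OF w] unfolding eq by (rule trans[OF sym])
qed

lemma funpow_primpts:
  assumes z: "z \<in> primpts d c n" and n: "n > 0" shows "(fmap d c ^^ i) z \<in> primpts d c n"
proof -
  let ?w = "(fmap d c ^^ i) z"
  have zf: "z \<in> fixpts d c n" using z by (simp add: primpts_def)
  have "?w \<notin> fixpts d c k" if k: "k \<in> {0<..<n}" for k
  proof
    assume "?w \<in> fixpts d c k"
    moreover have "(fmap d c ^^ (k + i)) z = (fmap d c ^^ (i + k)) z" by (simp only: add.commute)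
    ultimately have "(fmap d c ^^ i) ((fmap d c ^^ k) z) = (fmap d c ^^ i) z"
      by (simp add: fixpts_def funpow_add)
    then have "(fmap d c ^^ k) z = z"
      using fmap_inj_fixpts[OF n, where d=d and c=c and i=i] zf funpow_fixpts[OF zf] by (auto dest: inj_onD)
    then show False using z k by (auto simp: primpts_def fixpts_def)
  qed
  then show ?thesis using funpow_fixpts[OF zf] by (simp add: primpts_def)
qed

lemma finite_bij_funpow_primpts:
  assumes "n > 0" "finite (primpts d c n)"
  shows "bij_betw (fmap d c ^^ i) (primpts d c n) (primpts d c n)"
proof -
  have inj: "inj_on (fmap d c ^^ i) (primpts d c n)"
    using fmap_inj_fixpts[OF assms(1)] by (rule inj_on_subset) (auto simp: primpts_def)
  moreover have "(fmap d c ^^ i) ` primpts d c n \<subseteq> primpts d c n"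
    using funpow_primpts[OF _ assms(1)] by auto
  ultimately show ?thesis using endo_inj_surj[OF assms(2)] by (simp add: bij_betw_def)
qed

section \<open>Location and multipliers of periodic points\<close>

lemma fmap_diff: "fmap d c z - c = z ^ d * (z - c)"
  by (simp add: fmap_def)

lemma funpow_center: "d > 0 \<Longrightarrow> (fmap d c ^^ i) c = c"
  by (induction i) (simp_all add: fmap_def)

text \<open>
  Let \<open>\<rho>\<close> be the largest distance to \<open>c\<close> on the cycle. The identity \<open>|z|\<^sup>d |z - c| = |f(z) - c| \<le> \<rho>\<close> at the
  point where \<open>\<rho>\<close> is attained forbids \<open>\<rho> > 2|c|\<close>. With \<open>\<rho> \<le> 2|c|\<close> the same identity forces
  \<open>|z|\<close> or \<open>|z - c|\<close> to be small at every point.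
\<close>

lemma fixpts_dichotomy:
  assumes d: "d \<ge> 1" and c: "norm c > 8" and n: "n > 0" and z: "z \<in> fixpts d c n"
  shows "norm z \<le> 4 \<or> norm (z - c) \<le> 4"
proof -
  define S where "S = (\<lambda>i. norm ((fmap d c ^^ i) z - c)) ` {..n}"
  define \<rho> where "\<rho> = Max S"
  have fin: "finite S" "S \<noteq> {}" by (auto simp: S_def)
  have le: "norm ((fmap d c ^^ i) z - c) \<le> \<rho>" if "i \<le> n" for i
    unfolding \<rho>_def by (rule Max_ge[OF fin(1)]) (use that in \<open>auto simp: S_def\<close>)
  have step: "norm w ^ d * norm (w - c) \<le> \<rho>" if "w = (fmap d c ^^ i) z" "i < n" for w i
    using le[of "Suc i"] that fmap_diff[of d c w] by (simp add: norm_mult norm_power)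
  have "\<rho> \<in> S" unfolding \<rho>_def using fin by (rule Max_in)
  then obtain i0 where i0: "i0 \<le> n" "\<rho> = norm ((fmap d c ^^ i0) z - c)" by (auto simp: S_def)
  \<comment> \<open>the maximum may be attained at index \<open>n\<close>, which has no successor in the range\<close>
  define i where "i = i0 mod n"
  have i: "i < n" "\<rho> = norm ((fmap d c ^^ i) z - c)"
    using i0 n funpow_mod_period[of n "fmap d c" z i0] z by (auto simp: i_def fixpts_def)
  define w where "w = (fmap d c ^^ i) z"
  have \<rho>: "\<rho> \<le> 2 * norm c"
  proof (rule ccontr)
    assume "\<not> \<rho> \<le> 2 * norm c"
    then have \<rho>2: "\<rho> > 2 * norm c" by simp
    have "norm w \<ge> \<rho> - norm c"
      using norm_triangle_ineq4[of w c] i(2) by (simp add: w_def)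
    then have w8: "norm w > 8" using \<rho>2 c by linarith
    then have "norm w ^ d \<ge> norm w ^ 1" using d by (intro power_increasing) auto
    then have "norm w ^ d > 1" using w8 by simp
    then have "norm w ^ d * \<rho> > \<rho>" using \<rho>2 c by simp
    then show False using step[OF w_def i(1)] i(2) by (simp add: w_def)
  qed
  have st: "norm z ^ d * norm (z - c) \<le> 2 * norm c" using step[of z 0] n \<rho> by simp
  show ?thesis
  proof (cases "norm (z - c) \<le> norm c / 2")
    case True
    have "norm z \<ge> norm c / 2" using norm_triangle_ineq2[of c "c - z"] True
      by (simp add: norm_minus_commute)
    then have "norm z ^ d \<ge> norm z ^ 1" using d c by (intro power_increasing) auto
    then have "norm z ^ d \<ge> norm c / 2" using \<open>norm z \<ge> norm c / 2\<close> by simp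
    then have "norm c / 2 * norm (z - c) \<le> norm c / 2 * 4"
      using mult_right_mono[of "norm c / 2" "norm z ^ d" "norm (z - c)"] st by simp
    then show ?thesis using c by (subst (asm) mult_le_cancel_left_pos) auto
  next
    case False
    then have "norm z ^ d * (norm c / 2) \<le> 4 * (norm c / 2)"
      using mult_left_mono[of "norm c / 2" "norm (z - c)" "norm z ^ d"] st by simp
    then have z4: "norm z ^ d \<le> 4" using c by (subst (asm) mult_le_cancel_right_pos) auto
    have "norm z \<le> 4"
    proof (rule ccontr)
      assume "\<not> norm z \<le> 4"
      then have "norm z ^ d \<ge> norm z ^ 1" using d by (intro power_increasing) auto
      then show False using z4 \<open>\<not> norm z \<le> 4\<close> by simp
    qed
    then show ?thesis by simp
  qed
qed

text \<open>
  Multiply \<open>f(z) - c = z\<^sup>d (z - c)\<close> over the cycle. The factors \<open>z - c\<close> on the two sides are permuted and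
  cancel, which leaves \<open>(\<Prod>z)\<^sup>d = 1\<close>.
\<close>

lemma norm_prod_orbit:
  assumes d: "d \<ge> 1" and n: "n > 0" and z: "z \<in> fixpts d c n" and zc: "z \<noteq> c"
  shows "norm (\<Prod>i<n. (fmap d c ^^ i) z) = 1"
proof -
  let ?z = "\<lambda>i. (fmap d c ^^ i) z"
  have nc: "?z i \<noteq> c" for i
  proof
    assume "?z i = c"
    then have "?z i = (fmap d c ^^ i) c" using funpow_center d by simp
    moreover have "c \<in> fixpts d c n" using funpow_center d by (simp add: fixpts_def)
    ultimately show False using fmap_inj_fixpts[OF n, where d=d and c=c and i=i] z zc by (auto dest: inj_onD)
  qed
  have "(\<Prod>i<n. ?z (Suc i) - c) = (\<Prod>i<n. ?z i - c)"
  proof -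
    have "(\<Prod>i<n. ?z (Suc i) - c) * (?z 0 - c) = (\<Prod>i<n. ?z i - c) * (?z n - c)"
      by (induction n) (auto simp: mult_ac)
    then show ?thesis using z nc[of 0] by (simp add: fixpts_def)
  qed
  moreover have "(\<Prod>i<n. ?z (Suc i) - c) = (\<Prod>i<n. ?z i) ^ d * (\<Prod>i<n. ?z i - c)"
    by (simp add: fmap_diff prod.distrib prod_power_distrib)
  moreover have "(\<Prod>i<n. ?z i - c) \<noteq> 0" using nc by simp
  ultimately have "(\<Prod>i<n. ?z i) ^ d = 1" by simp
  then have "norm (\<Prod>i<n. ?z i) ^ d = 1" by (metis norm_one norm_power)
  then show ?thesis using d power_eq_imp_eq_base[of "norm (\<Prod>i<n. ?z i)" d 1] by simp
qed

lemma norm_cycle_slope: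
  assumes "d \<ge> 1" "n > 0" "z \<in> fixpts d c n" "z \<noteq> c"
  shows "norm (cycle_slope d c D n z) =
    (\<Prod>i<n. norm ((fmap d c ^^ i) z + D * ((fmap d c ^^ i) z - c)))"
  using norm_prod_orbit[OF assms]
  by (simp add: cycle_slope_def slope_def prod.distrib norm_mult prod_norm
        prod_power_distrib[symmetric] norm_power)

lemma cycle_slope_center:
  assumes "d \<ge> 1" shows "cycle_slope d c D n c = c ^ (d * n)"
  using funpow_center[where d = d and c = c] assms by (cases d) (simp_all add: cycle_slope_def slope_def power_mult power_add power_mult_distrib mult_ac)

text \<open>
  Near \<open>c\<close> the factor is \<open>c + (1 + D)(z - c)\<close>, near \<open>0\<close> it is \<open>-Dc + (1 + D)z\<close>.
\<close>

lemma norm_slope_factor_bounds: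
  fixes z c D :: complex
  assumes D: "norm (1 + D) \<le> K"
  shows "norm (z - c) \<le> 4 \<Longrightarrow> norm (z + D * (z - c)) \<le> norm c + 4 * K"
    and "norm (z - c) \<le> 4 \<Longrightarrow> norm (z + D * (z - c)) \<ge> norm c - 4 * K"
    and "norm z \<le> 4 \<Longrightarrow> norm (z + D * (z - c)) \<le> norm D * norm c + 4 * K"
    and "norm z \<le> 4 \<Longrightarrow> norm (z + D * (z - c)) \<ge> norm D * norm c - 4 * K"
proof -
  have *: "norm ((1 + D) * y) \<le> 4 * K" if "norm y \<le> 4" for y
  proof -
    have "norm ((1 + D) * y) = norm (1 + D) * norm y" by (rule norm_mult)
    also have "\<dots> \<le> K * 4"
      using D that by (intro mult_mono) (auto intro: order_trans[OF norm_ge_zero])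
    finally show ?thesis by simp
  qed
  have 1: "z + D * (z - c) = c + (1 + D) * (z - c)" by (simp add: algebra_simps)
  have 2: "z + D * (z - c) = - (D * c) + (1 + D) * z" by (simp add: algebra_simps)
  show "norm (z - c) \<le> 4 \<Longrightarrow> norm (z + D * (z - c)) \<le> norm c + 4 * K"
    unfolding 1 using *[of "z - c"] norm_triangle_ineq[of c "(1 + D) * (z - c)"] by linarith
  show "norm (z - c) \<le> 4 \<Longrightarrow> norm (z + D * (z - c)) \<ge> norm c - 4 * K"
    unfolding 1 using *[of "z - c"] norm_diff_ineq[of c "(1 + D) * (z - c)"] by linarith
  show "norm z \<le> 4 \<Longrightarrow> norm (z + D * (z - c)) \<le> norm D * norm c + 4 * K"
    unfolding 2 using *[of z] norm_triangle_ineq[of "- (D * c)" "(1 + D) * z"]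
    by (simp add: norm_mult)
  show "norm z \<le> 4 \<Longrightarrow> norm (z + D * (z - c)) \<ge> norm D * norm c - 4 * K"
    unfolding 2 using *[of z] norm_diff_ineq[of "- (D * c)" "(1 + D) * z"]
    by (simp add: norm_mult)
qed

lemma norm_cycle_slope_gt_1:
  assumes d: "d \<ge> 1" and c: "norm c > 8 * (real d + 1)" and n: "n > 0" and z: "z \<in> fixpts d c n"
  shows "norm (cycle_slope d c (of_nat d) n z) > 1"
proof (cases "z = c")
  case True
  have "d * n > 0" "norm c > 1" using d n c by auto
  then show ?thesis using True d by (simp add: cycle_slope_center norm_power)
next
  case False
  have c8: "norm c > 8" using c d by (smt (verit) of_nat_0_le_iff)
  have K: "norm (1 + of_nat d :: complex) \<le> real d + 1"
    using norm_triangle_ineq[of "1::complex" "of_nat d"] by simp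
  have dc: "real d * norm c \<ge> norm c" using d mult_right_mono[of 1 "real d" "norm c"] by simp
  have "norm ((fmap d c ^^ i) z + of_nat d * ((fmap d c ^^ i) z - c)) > 1" for i
    using fixpts_dichotomy[OF d c8 n funpow_fixpts[OF z, of i]]
      norm_slope_factor_bounds(2,4)[OF K, of "(fmap d c ^^ i) z" c] c dc by fastforce
  then have "(\<Prod>i<n. norm ((fmap d c ^^ i) z + of_nat d * ((fmap d c ^^ i) z - c))) > 1"
    using n by (intro less_1_prod) auto
  then show ?thesis using norm_cycle_slope[OF d n z False] by simp
qed

section \<open>Rotating the parameter\<close>

text \<open>
  The polynomial \<open>(z - c) z\<^sup>d + c\<close> is homogeneous of degree 1 modulo \<open>d\<close> in \<open>(z, c)\<close>.
\<close>

lemma funpow_rotate: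
  assumes "\<zeta> ^ d = 1" shows "(fmap d (\<zeta> * c) ^^ i) (\<zeta> * z) = \<zeta> * (fmap d c ^^ i) z"
  by (induction i) (simp_all add: fmap_def power_mult_distrib assms algebra_simps)

lemma primpts_rotate:
  assumes "\<zeta> ^ d = 1" "d \<ge> 1" shows "primpts d (\<zeta> * c) n = (\<lambda>z. \<zeta> * z) ` primpts d c n"
proof -
  have z0: "\<zeta> \<noteq> 0" using assms by (auto simp: power_0_left)
  have *: "\<zeta> * z \<in> fixpts d (\<zeta> * c) k \<longleftrightarrow> z \<in> fixpts d c k" for z k
    using z0 funpow_rotate[OF assms(1)] by (simp add: fixpts_def)
  have **: "\<zeta> * z \<in> primpts d (\<zeta> * c) n \<longleftrightarrow> z \<in> primpts d c n" for z
    unfolding primpts_def mem_Collect_eq * ..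
  show ?thesis
  proof (intro equalityI subsetI)
    fix w assume "w \<in> primpts d (\<zeta> * c) n"
    moreover have w: "w = \<zeta> * (w / \<zeta>)" using z0 by simp
    ultimately have "w / \<zeta> \<in> primpts d c n" using **[of "w / \<zeta>"] by simp
    then show "w \<in> (\<lambda>z. \<zeta> * z) ` primpts d c n" using w by blast
  next
    fix w assume "w \<in> (\<lambda>z. \<zeta> * z) ` primpts d c n"
    then show "w \<in> primpts d (\<zeta> * c) n" using ** by blast
  qed
qed

lemma cycle_slope_rotate:
  assumes "\<zeta> ^ d = 1" "d \<ge> 1" shows "cycle_slope d (\<zeta> * c) D n (\<zeta> * z) = cycle_slope d c D n z"
proof -
  have "\<zeta> ^ (d - 1) * \<zeta> = 1" using assms by (cases d) (simp_all add: mult.commute)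
  moreover have "slope d (\<zeta> * c) D (\<zeta> * z) = (\<zeta> ^ (d - 1) * \<zeta>) * slope d c D z" for z
    by (simp add: slope_def power_mult_distrib algebra_simps)
  ultimately have "slope d (\<zeta> * c) D (\<zeta> * z) = slope d c D z" for z by simp
  then show ?thesis by (simp add: cycle_slope_def funpow_rotate[OF assms(1)])
qed

lemma cycle_slope_shift:
  assumes "z \<in> fixpts d c n" "d \<ge> 1"
  shows "cycle_slope d c D n (fmap d c z) = cycle_slope d c D n z"
proof -
  let ?g = "\<lambda>i. slope d c D ((fmap d c ^^ i) z)"
  have "cycle_slope d c D n (fmap d c z) = (\<Prod>i<n. ?g (Suc i))"
    by (simp add: cycle_slope_def funpow_swap1)
  also have "\<dots> = (\<Prod>i<n. ?g i)"
  proof (cases n)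
    case (Suc k)
    have "?g (Suc k) = ?g 0" using assms Suc by (simp add: fixpts_def)
    have "(\<Prod>i<Suc k. ?g (Suc i)) = (\<Prod>i<k. ?g (Suc i)) * ?g 0"
      using \<open>?g (Suc k) = ?g 0\<close> by (simp only: prod.lessThan_Suc)
    also have "\<dots> = (\<Prod>i<Suc k. ?g i)"
      by (simp only: prod.lessThan_Suc_shift mult.commute[of "?g 0"])
    finally show ?thesis unfolding Suc .
  qed simp
  finally show ?thesis by (simp add: cycle_slope_def)
qed

section \<open>Resultants and roots\<close>

definition vandermonde :: "'a :: comm_ring_1 list \<Rightarrow> 'a mat" where
  "vandermonde as = mat (length as) (length as) (\<lambda>(i, k). (as ! k) ^ (length as - 1 - i))"

text \<open>
  A vector in the kernel of the transpose lists the coefficients of a polynomial of degree less than \<open>n\<close> that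
  has \<open>n\<close> roots.
\<close>

lemma det_vandermonde_nonzero:
  fixes as :: "'a :: field list"
  assumes dist: "distinct as" shows "det (vandermonde as) \<noteq> 0"
proof
  let ?n = "length as"
  have car: "transpose_mat (vandermonde as) \<in> carrier_mat ?n ?n" by (auto simp: vandermonde_def)
  assume "det (vandermonde as) = 0"
  then have "det (transpose_mat (vandermonde as)) = 0"
    using det_transpose[of "vandermonde as" ?n] by (simp add: vandermonde_def)
  then obtain v where v: "v \<in> carrier_vec ?n" "v \<noteq> 0\<^sub>v ?n"
    "transpose_mat (vandermonde as) *\<^sub>v v = 0\<^sub>v ?n"
    using det_0_iff_vec_prod_zero_field[OF car] by auto
  define p where "p = (\<Sum>i<?n. monom (v $ i) (?n - 1 - i))"
  have root: "poly p (as ! k) = 0" if "k < ?n" for k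
  proof -
    have "(transpose_mat (vandermonde as) *\<^sub>v v) $ k = poly p (as ! k)"
      using that v(1) by (auto simp: p_def vandermonde_def scalar_prod_def poly_sum poly_monom
          atLeast0LessThan mult.commute intro!: sum.cong)
    then show ?thesis using v(3) that by simp
  qed
  have coeff: "coeff p (?n - 1 - i) = v $ i" if "i < ?n" for i
  proof -
    have "coeff p (?n - 1 - i) = (\<Sum>j<?n. if j = i then v $ j else 0)"
      unfolding p_def coeff_sum coeff_monom using that by (intro sum.cong) auto
    then show ?thesis using that by simp
  qed
  have "p = 0"
  proof (rule ccontr)
    assume p0: "p \<noteq> 0"
    have "degree p \<le> ?n - 1" unfolding p_def
      by (intro degree_sum_le) (auto intro: order_trans[OF degree_monom_le])
    moreover have "?n > 0" using p0 by (auto simp: p_def)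
    moreover have "card (set as) \<le> card {x. poly p x = 0}"
      using root poly_roots_finite[OF p0] by (intro card_mono) (auto simp: in_set_conv_nth)
    moreover have "card {x. poly p x = 0} \<le> degree p" using p0 by (rule card_poly_roots_bound)
    ultimately show False using distinct_card[OF dist] by linarith
  qed
  then have "v = 0\<^sub>v ?n" using v(1) coeff by (intro eq_vecI) auto
  then show False using v(2) by simp
qed

lemma index_mult_mat_sum:
  assumes "A \<in> carrier_mat n m" "B \<in> carrier_mat m l" "i < n" "k < l"
  shows "(A * B) $$ (i, k) = (\<Sum>j<m. A $$ (i, j) * B $$ (j, k))"
  using assms by (auto simp: scalar_prod_def atLeast0LessThan)

text \<open>
  For distinct roots, multiply the Sylvester matrix on the right by the matrix whose first columns are unit
  vectors and whose last columns list the powers of the roots. Evaluation at a root kills the rows of \<open>p\<close>,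
  so that the product is block triangular: a unitriangular block, and the Vandermonde matrix with its columns
  scaled by the values of \<open>q\<close>. The determinant of the Vandermonde matrix cancels.
\<close>

lemma resultant_prod_roots:
  fixes as :: "'a :: field list"
  assumes dist: "distinct as"
  shows "resultant (\<Prod>a\<leftarrow>as. [:-a, 1:]) q = (\<Prod>a\<leftarrow>as. poly q a)"
proof -
  define p where "p = (\<Prod>a\<leftarrow>as. [:-a, 1:])"
  define n e where "n = length as" and "e = degree q"
  have lead: "lead_coeff p = 1" and deg: "degree p = n"
  proof -
    have "lead_coeff p = 1 \<and> degree p = n" unfolding p_def n_def
    proof (induction as)
      case (Cons a as)
      let ?r = "\<Prod>a\<leftarrow>as. [:-a, 1:]"
      have "?r \<noteq> 0" using Cons by auto
      then have "degree ([:-a, 1:] * ?r) = Suc (length as)"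
        by (subst degree_mult_eq) (use Cons in auto)
      moreover have "lead_coeff ([:-a, 1:] * ?r) = 1" by (subst lead_coeff_mult) (use Cons in auto)
      ultimately show ?case by (simp del: mult_pCons_left)
    qed simp
    then show "lead_coeff p = 1" "degree p = n" by auto
  qed
  have roots: "poly p a = 0" if "a \<in> set as" for a
    using that unfolding p_def by (induction as) auto
  let ?S = "sylvester_mat p q"
  let ?V = "vandermonde as"
  let ?W = "mat e n (\<lambda>(i, k). (as ! k) ^ (n + e - Suc i))"
  let ?U = "four_block_mat (1\<^sub>m e) ?W (0\<^sub>m n e) ?V"
  let ?T = "mat e e (\<lambda>(i, j). ?S $$ (i, j))"
  let ?L = "mat n e (\<lambda>(i, j). ?S $$ (i + e, j))"
  let ?Q = "mat n n (\<lambda>(i, j). if i = j then poly q (as ! i) else 0)"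
  let ?R = "four_block_mat ?T (0\<^sub>m e n) ?L (?V * ?Q)"
  have S: "?S \<in> carrier_mat (e + n) (e + n)"
    using sylvester_carrier_mat[of p q] by (simp add: deg e_def add.commute)
  have V: "?V \<in> carrier_mat n n" by (simp add: vandermonde_def n_def)
  have U: "?U \<in> carrier_mat (e + n) (e + n)" by (intro four_block_carrier_mat) (use V in auto)
  have entry: "?S $$ (i, j) = (if i < e then coeff (monom 1 (e - 1 - i) * p) (n + e - 1 - j)
      else coeff (monom 1 (n + e - 1 - i) * q) (n + e - 1 - j))" if "i < e + n" "j < e + n" for i j
  proof -
    have *: "coeff (monom 1 (Suc a) * r) (Suc b) = coeff (monom 1 a * r) b" for a b and r :: "'a poly"
      by (simp add: coeff_monom_mult)
    have j: "Suc (n + e - 1 - j) = n + e - j" "Suc (n + e - 1 - i) = n + e - i"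
      using that by auto
    have "coeff (monom 1 (e - i) * p) (n + e - j) = coeff (monom 1 (e - 1 - i) * p) (n + e - 1 - j)"
      if "i < e"
    proof -
      have "Suc (e - 1 - i) = e - i" using that by simp
      then show ?thesis using *[of "e - 1 - i" p "n + e - 1 - j"] unfolding j by simp
    qed
    moreover have "coeff (monom 1 (n + e - i) * q) (n + e - j) =
        coeff (monom 1 (n + e - 1 - i) * q) (n + e - 1 - j)"
      using *[of "n + e - 1 - i" q "n + e - 1 - j"] unfolding j .
    moreover have "?S $$ (i, j) = (if i < e then coeff (monom 1 (e - i) * p) (n + e - j)
      else coeff (monom 1 (n + e - i) * q) (n + e - j))"
      using sylvester_index_mat2[of i p q j] that unfolding deg e_def[symmetric] by simp
    ultimately show ?thesis by simp
  qed
  have ev: "(\<Sum>j<e + n. coeff r (n + e - 1 - j) * a ^ (n + e - 1 - j)) = poly r a"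
    if "degree r < n + e" for r :: "'a poly" and a
  proof -
    have "(\<Sum>j<e + n. coeff r (n + e - 1 - j) * a ^ (n + e - 1 - j))
      = (\<Sum>j<e + n. coeff r j * a ^ j)"
      by (rule sum.reindex_bij_witness[of _ "\<lambda>j. n + e - 1 - j" "\<lambda>j. n + e - 1 - j"]) auto
    also have "\<dots> = (\<Sum>j\<le>degree r. coeff r j * a ^ j)"
      using that by (intro sum.mono_neutral_right) (auto simp: coeff_eq_0)
    finally show ?thesis by (simp add: poly_altdef)
  qed
  have degs: "degree (monom 1 k * r) \<le> k + degree r" for k and r :: "'a poly"
    using degree_mult_le[of "monom 1 k" r] degree_monom_le[of "1::'a" k] by linarith
  have Ucol: "?U $$ (j, k) = (if k < e then (if j = k then 1 else 0) else (as ! (k - e)) ^ (n + e - Suc j))"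
    if "j < e + n" "k < e + n" for j k
    using that V by (auto simp: vandermonde_def n_def[symmetric] add.commute)
  have SU: "?S * ?U = ?R"
  proof (rule eq_matI)
    fix i k assume "i < dim_row ?R" "k < dim_col ?R"
    then have i: "i < e + n" and k: "k < e + n" using V by auto
    have "(?S * ?U) $$ (i, k) = (\<Sum>j<e + n. ?S $$ (i, j) * ?U $$ (j, k))"
      by (rule index_mult_mat_sum[OF S U i k])
    also have "\<dots> = ?R $$ (i, k)"
    proof (cases "k < e")
      case True
      have "(\<Sum>j<e + n. ?S $$ (i, j) * ?U $$ (j, k)) = (\<Sum>j<e + n. if j = k then ?S $$ (i, j) else 0)"
        using True k by (intro sum.cong) (simp_all add: Ucol)
      also have "\<dots> = ?S $$ (i, k)" using k by simp
      finally show ?thesis using i k True V by auto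
    next
      case False
      define a where "a = as ! (k - e)"
      have ke: "k - e < n" using False k by simp
      have a: "a \<in> set as" using ke by (simp add: a_def n_def)
      define r where "r = (if i < e then monom 1 (e - 1 - i) * p else monom 1 (n + e - 1 - i) * q)"
      have "degree r < n + e" using degs[of "e - 1 - i" p] degs[of "n + e - 1 - i" q] i
        by (auto simp: r_def deg e_def[symmetric])
      have "(\<Sum>j<e + n. ?S $$ (i, j) * ?U $$ (j, k))
          = (\<Sum>j<e + n. coeff r (n + e - 1 - j) * a ^ (n + e - 1 - j))"
        using i k False by (intro sum.cong) (auto simp: Ucol entry r_def a_def)
      also have "\<dots> = poly r a" by (rule ev) fact
      also have "\<dots> = ?R $$ (i, k)"
      proof (cases "i < e")
        case True
        then show ?thesis using i k False V roots[OF a] by (simp add: r_def)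
      next
        case iF: False
        have "(?V * ?Q) $$ (i - e, k - e) = (\<Sum>j<n. ?V $$ (i - e, j) * ?Q $$ (j, k - e))"
          by (rule index_mult_mat_sum[OF V]) (use iF i ke in auto)
        also have "\<dots> = (\<Sum>j<n. if j = k - e then ?V $$ (i - e, j) * poly q a else 0)"
          using ke by (intro sum.cong) (auto simp: a_def)
        also have "\<dots> = a ^ (n - 1 - (i - e)) * poly q a"
          using iF i ke by (simp add: vandermonde_def n_def[symmetric] a_def)
        also have "n - 1 - (i - e) = n + e - 1 - i" using iF i by simp
        finally show ?thesis using iF i k False V by (simp add: r_def poly_monom)
      qed
      finally show ?thesis .
    qed
    finally show "(?S * ?U) $$ (i, k) = ?R $$ (i, k)" .
  qed (use S U V in auto)
  have detU: "det ?U = det ?V"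
    by (subst det_four_block_mat_lower_left_zero[of _ e _ n]) (use V in auto)
  have detT: "det ?T = 1"
  proof -
    have "upper_triangular ?T" unfolding upper_triangular_def
    proof (intro allI impI)
      fix i j assume "i < dim_row ?T" "j < i"
      then show "?T $$ (i, j) = 0"
        by (auto simp: entry coeff_monom_mult deg intro!: coeff_eq_0)
    qed
    then have "det ?T = prod_list (diag_mat ?T)" by (rule det_upper_triangular) auto
    also have "diag_mat ?T = replicate e 1"
      using lead by (intro nth_equalityI) (auto simp: diag_mat_def entry coeff_monom_mult deg)
    finally show ?thesis by simp
  qed
  have detQ: "det ?Q = (\<Prod>a\<leftarrow>as. poly q a)"
  proof -
    have "det ?Q = prod_list (diag_mat ?Q)"
      by (rule det_upper_triangular[of _ n]) (auto simp: upper_triangular_def)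
    also have "diag_mat ?Q = map (poly q) as"
      by (intro nth_equalityI) (auto simp: diag_mat_def n_def)
    finally show ?thesis .
  qed
  have "det ?S * det ?V = det (?S * ?U)" using det_mult[OF S U] detU by simp
  also have "\<dots> = det ?T * det (?V * ?Q)" unfolding SU
    by (rule det_four_block_mat_upper_right_zero) (use V in auto)
  also have "\<dots> = det ?V * (\<Prod>a\<leftarrow>as. poly q a)" using det_mult[of ?V n ?Q] V detT detQ by simp
  finally show ?thesis using det_vandermonde_nonzero[OF dist] by (simp add: resultant_def p_def)
qed

lemma resultant_prod_roots_set:
  fixes A :: "'a :: field set"
  assumes "finite A"
  shows "resultant (\<Prod>a\<in>A. [:-a, 1:]) q = (\<Prod>a\<in>A. poly q a)"
proof -
  obtain as where "set as = A" "distinct as" using finite_distinct_list[OF assms] by blast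
  then show ?thesis using resultant_prod_roots[of as q] by (simp add: prod.distinct_set_conv_list[symmetric])
qed

section \<open>Specialising the parameter\<close>

definition spec :: "complex \<Rightarrow> int poly \<Rightarrow> complex" where
  "spec c p = poly (of_int_poly p) c"

interpretation spec: comm_ring_hom "spec c" for c
  by unfold_locales (simp_all add: spec_def hom_distribs)

interpretation spec: idom_hom "spec c" for c ..

interpretation spec_poly: map_poly_comm_ring_hom "spec c" for c ..

definition eval2 :: "int poly poly \<Rightarrow> complex \<Rightarrow> complex \<Rightarrow> complex" where
  "eval2 A u v = poly (map_poly (spec u) A) v"

interpretation eval2: comm_ring_hom "\<lambda>A. eval2 A u v" for u v
  by unfold_locales (simp_all add: eval2_def hom_distribs)

lemma spec_pCons [simp]: "spec c (pCons a p) = of_int a + c * spec c p"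
  by (cases "a = 0 \<and> p = 0") (auto simp: spec_def map_poly_pCons)

lemma eval2_pCons [simp]: "eval2 (pCons a A) u v = spec u a + v * eval2 A u v"
  by (cases "a = 0 \<and> A = 0") (auto simp: eval2_def map_poly_pCons)

lemma spec_of_nat [simp]: "spec c (of_nat k) = of_nat k"
  by (induction k) (simp_all add: hom_distribs)

lemma infinite_norm_gt: "infinite {c :: complex. norm c > R}"
proof
  assume "finite {c :: complex. norm c > R}"
  then have "finite (norm ` {c :: complex. norm c > R})" by simp
  moreover have "{max 0 R<..} \<subseteq> norm ` {c :: complex. norm c > R}"
  proof
    fix r assume "r \<in> {max 0 R<..}"
    then show "r \<in> norm ` {c :: complex. norm c > R}"
      by (intro image_eqI[of _ _ "of_real r"]) auto
  qed
  ultimately show False using infinite_Ioi finite_subset by blast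
qed

lemma poly_eq_0_if_large_roots:
  fixes p :: "complex poly"
  assumes "\<And>c. norm c > R \<Longrightarrow> poly p c = 0" shows "p = 0"
proof (rule ccontr)
  assume "p \<noteq> 0"
  then have "finite {c. poly p c = 0}" by (rule poly_roots_finite)
  moreover have "{c. norm c > R} \<subseteq> {c. poly p c = 0}" using assms by auto
  ultimately have "finite {c :: complex. norm c > R}" by (rule rev_finite_subset)
  then show False using infinite_norm_gt by auto
qed

lemma spec_eq_0:
  assumes "\<And>c. norm c > R \<Longrightarrow> spec c p = 0" shows "p = 0"
proof -
  have "(of_int_poly p :: complex poly) = 0"
    using assms by (intro poly_eq_0_if_large_roots[of R]) (simp add: spec_def)
  then show ?thesis by simp
qed

lemma map_poly_spec_eq_0:
  assumes "\<And>c. norm c > R \<Longrightarrow> map_poly (spec c) A = 0" shows "A = 0"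
proof (rule poly_eqI)
  fix i
  have "spec c (coeff A i) = 0" if "norm c > R" for c
    using arg_cong[OF assms[OF that], of "\<lambda>p. coeff p i"] by simp
  then show "coeff A i = coeff 0 i" using spec_eq_0[of R "coeff A i"] by simp
qed

lemma eval2_eqI:
  assumes "\<And>u v. norm u > R \<Longrightarrow> eval2 A u v = eval2 B u v" shows "A = B"
proof -
  have "map_poly (spec u) (A - B) = 0" if "norm u > R" for u
    using assms[OF that] by (intro poly_eq_0_if_large_roots[of 0]) (simp add: eval2_def hom_distribs)
  then show ?thesis using map_poly_spec_eq_0[of R "A - B"] by simp
qed

lemma eval2_eqI':
  assumes "\<And>u v. norm v > R \<Longrightarrow> eval2 A u v = eval2 B u v" shows "A = B"
proof -
  have "map_poly (spec u) (A - B) = 0" for u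
    using assms by (intro poly_eq_0_if_large_roots[of R]) (simp add: eval2_def hom_distribs)
  then show ?thesis using map_poly_spec_eq_0[of 0 "A - B"] by simp
qed

lemma degree_map_poly_spec_monic:
  assumes "lead_coeff A = 1"
  shows "degree (map_poly (spec c) A) = degree A" "lead_coeff (map_poly (spec c) A) = 1"
proof -
  have "coeff (map_poly (spec c) A) (degree A) = 1" using assms by simp
  then show *: "degree (map_poly (spec c) A) = degree A"
    by (metis degree_map_poly_le le_antisym le_degree zero_neq_one)
  show "lead_coeff (map_poly (spec c) A) = 1" using assms unfolding * by simp
qed

lemma eval2_embed_const: "eval2 (map_poly (\<lambda>k. [:k:]) a) u v = spec v a"
proof -
  have "map_poly (spec u) (map_poly (\<lambda>k. [:k:]) a) = of_int_poly a"
    by (intro poly_eqI) (simp add: coeff_map_poly)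
  then show ?thesis by (simp add: eval2_def spec_def)
qed

lemma eval2_of_nat: "eval2 (of_nat b) u v = of_nat b"
  by (simp add: of_nat_poly)

text \<open>
  Degrees in \<open>c\<close> hide in the coefficients of a polynomial in \<open>\<int>[c][x]\<close>; the exchange of the variables
  makes them degrees of the outer variable.
\<close>

lemma exists_swap: "\<exists>B. \<forall>u v. eval2 B v u = eval2 A u v"
proof (induction A)
  case (pCons a A)
  then obtain B where B: "\<And>u v. eval2 B v u = eval2 A u v" by blast
  have "eval2 (map_poly (\<lambda>k. [:k:]) a + [:[:0, 1:]:] * B) v u = eval2 (pCons a A) u v" for u v
    by (simp only: eval2.hom_add eval2.hom_mult B eval2_embed_const) simp
  then show ?case by blast
qed (intro exI[of _ 0], simp)

section \<open>Roots of monic polynomials\<close>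

lemma coeff_mult_top:
  assumes "degree p \<le> a" "degree q \<le> b"
  shows "coeff (p * q) (a + b) = coeff p a * coeff q b"
proof -
  have "coeff (p * q) (a + b) = (\<Sum>i\<le>a + b. coeff p i * coeff q (a + b - i))" by (rule coeff_mult)
  also have "\<dots> = (\<Sum>i\<le>a + b. if i = a then coeff p a * coeff q b else 0)"
  proof (intro sum.cong refl)
    fix i assume "i \<in> {..a + b}"
    then show "coeff p i * coeff q (a + b - i) = (if i = a then coeff p a * coeff q b else 0)"
      using assms by (cases i a rule: linorder_cases) (auto simp: coeff_eq_0)
  qed
  also have "\<dots> = coeff p a * coeff q b" by simp
  finally show ?thesis .
qed

lemma power_top:
  assumes "degree p \<le> a"
  shows "degree (p ^ k) \<le> k * a" "coeff (p ^ k) (k * a) = coeff p a ^ k"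
proof -
  have "degree (p ^ k) \<le> k * a \<and> coeff (p ^ k) (k * a) = coeff p a ^ k"
  proof (induction k)
    case (Suc k)
    then have "degree (p * p ^ k) \<le> a + k * a"
      using degree_mult_le[of p "p ^ k"] assms by linarith
    moreover have "coeff (p * p ^ k) (a + k * a) = coeff p a * coeff (p ^ k) (k * a)"
      using Suc assms by (intro coeff_mult_top) auto
    ultimately show ?case using Suc by simp
  qed simp
  then show "degree (p ^ k) \<le> k * a" "coeff (p ^ k) (k * a) = coeff p a ^ k" by auto
qed

lemma degree_power_monic:
  fixes p :: "'a :: comm_ring_1 poly"
  assumes "lead_coeff p = 1" shows "degree (p ^ k) = k * degree p"
proof (rule le_antisym)
  show "degree (p ^ k) \<le> k * degree p" by (rule power_top(1)[OF order_refl])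
  have "coeff (p ^ k) (k * degree p) = 1" using power_top(2)[OF order_refl, of p k] assms by simp
  then show "k * degree p \<le> degree (p ^ k)" by (intro le_degree) simp
qed

text \<open>
  Two polynomials with the same top coefficient \<open>K\<close>: the cofactor of \<open>p - q\<close> in \<open>p\<^sup>m - q\<^sup>m\<close> is a sum of \<open>m\<close>
  terms that all have top coefficient \<open>K\<^bsup>m-1\<^esup>\<close>, so nothing cancels in characteristic 0.
\<close>

lemma power_diff_factor:
  fixes p q :: "'a :: comm_ring_1 poly"
  assumes "degree p \<le> n" "degree q \<le> n" "coeff p n = K" "coeff q n = K" "m > 0"
  obtains S where "p ^ m - q ^ m = (p - q) * S" "degree S \<le> (m - 1) * n"
    "coeff S ((m - 1) * n) = of_nat m * K ^ (m - 1)"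
proof
  let ?S = "\<Sum>i<m. q ^ (m - Suc i) * p ^ i"
  show "p ^ m - q ^ m = (p - q) * ?S" by (rule power_diff_sumr2)
  have e: "(m - 1) * n = (m - Suc i) * n + i * n" if "i < m" for i
    using that by (simp add: add_mult_distrib[symmetric])
  show "degree ?S \<le> (m - 1) * n"
  proof (intro degree_sum_le)
    fix i assume "i \<in> {..<m}"
    then show "degree (q ^ (m - Suc i) * p ^ i) \<le> (m - 1) * n"
      using degree_mult_le[of "q ^ (m - Suc i)" "p ^ i"] power_top(1)[OF assms(1), of i]
        power_top(1)[OF assms(2), of "m - Suc i"] e[of i] by simp
  qed simp
  have "coeff (q ^ (m - Suc i) * p ^ i) ((m - 1) * n) = K ^ (m - 1)" if "i < m" for i
    unfolding e[OF that]
    using that assms power_top[OF assms(1), of i] power_top[OF assms(2), of "m - Suc i"]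
    by (simp add: coeff_mult_top power_add[symmetric])
  then show "coeff ?S ((m - 1) * n) = of_nat m * K ^ (m - 1)"
    by (simp add: coeff_sum)
qed

lemma power_eq_imp_eq_same_lead:
  fixes p q :: "'a :: {idom, ring_char_0} poly"
  assumes "degree p \<le> n" "degree q \<le> n" "coeff p n = K" "coeff q n = K" "K \<noteq> 0" "m > 0"
    and small: "\<And>l. l \<ge> (m - 1) * n \<Longrightarrow> coeff (p ^ m - q ^ m) l = 0"
  shows "p = q"
proof (rule ccontr)
  assume ne: "p \<noteq> q"
  obtain S where S: "p ^ m - q ^ m = (p - q) * S" "degree S \<le> (m - 1) * n"
    "coeff S ((m - 1) * n) = of_nat m * K ^ (m - 1)"
    using power_diff_factor[OF assms(1-4,6)] by blast
  have cS: "coeff S ((m - 1) * n) \<noteq> 0" using S(3) assms by simp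
  then have "degree S = (m - 1) * n" "S \<noteq> 0" using S(2) by (auto intro: le_antisym le_degree)
  then have "coeff ((p - q) * S) (degree (p - q) + (m - 1) * n) \<noteq> 0"
    using ne coeff_mult_degree_sum[of "p - q" S] leading_coeff_neq_0[of "p - q"] cS
    by (simp del: coeff_diff)
  then show False using small S(1) by simp
qed

lemma monic_root_unique:
  fixes p q :: "'a :: {idom, ring_char_0} poly"
  assumes "p ^ m = q ^ m" "lead_coeff p = 1" "lead_coeff q = 1" "m > 0" shows "p = q"
proof -
  have "degree (r ^ m) = m * degree r" if "lead_coeff r = 1" for r :: "'a poly"
    using that by (rule degree_power_monic)
  then have "degree p = degree q" using assms by (metis mult_left_cancel not_gr_zero)
  then show ?thesis using assms by (intro power_eq_imp_eq_same_lead[of p "degree p" q 1 m]) auto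
qed

text \<open>
  The coefficients of an \<open>m\<close>-th root are determined one after another from the top. Denominators are
  avoided by carrying a common multiple \<open>K\<close>: to correct the coefficient of index \<open>m n - j - 1\<close> by the
  error \<open>e\<close>, scale \<open>B\<close> by \<open>t = m K\<^bsup>m-1\<^esup>\<close> and add \<open>e z\<^bsup>n-j-1\<^esup>\<close>.
\<close>

lemma approximate_root:
  fixes A :: "'a :: {idom, ring_char_0} poly"
  assumes "degree A = m * n" "lead_coeff A = 1" "m > 0" "j \<le> n"
  shows "\<exists>(K :: nat) B. K > 0 \<and> degree B \<le> n \<and> coeff B n = of_nat K \<and>
    (\<forall>l. l + j \<ge> m * n \<longrightarrow> coeff (Polynomial.smult (of_nat K ^ m) A - B ^ m) l = 0)"
  using assms(4)
proof (induction j)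
  case 0
  have "degree (monom 1 n :: 'a poly) \<le> n" by (rule degree_monom_le)
  note top = power_top[OF this, of m]
  have "coeff (Polynomial.smult (of_nat 1 ^ m) A - monom 1 n ^ m) l = 0" if "l + 0 \<ge> m * n" for l
    using that assms(1,2) top by (cases "l = m * n") (auto simp: coeff_eq_0)
  then show ?case by (intro exI[of _ 1] exI[of _ "monom 1 n"]) (auto simp: degree_monom_le)
next
  case (Suc j)
  then obtain K :: nat and B where K: "K > 0" "degree B \<le> n" "coeff B n = of_nat K"
    and B: "\<And>l. l + j \<ge> m * n \<Longrightarrow> coeff (Polynomial.smult (of_nat K ^ m) A - B ^ m) l = 0" by auto
  define t where "t = m * K ^ (m - 1)"
  define l0 where "l0 = m * n - Suc j"
  define e where "e = coeff (Polynomial.smult (of_nat K ^ m) A - B ^ m) l0"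
  define h where "h = monom e (n - Suc j)"
  have mn: "m * n = (m - 1) * n + n" using assms(3) by (cases m) auto
  have l0: "l0 = n - Suc j + (m - 1) * n" using Suc.prems mn by (simp add: l0_def)
  have h: "degree h \<le> n - Suc j" unfolding h_def by (rule degree_monom_le)
  have tB: "degree (Polynomial.smult (of_nat t) B) \<le> n" "coeff (Polynomial.smult (of_nat t) B) n = of_nat (t * K)"
    using K by auto
  have B': "degree (Polynomial.smult (of_nat t) B + h) \<le> n" "coeff (Polynomial.smult (of_nat t) B + h) n = of_nat (t * K)"
    using tB h Suc.prems by (auto intro!: degree_add_le simp: coeff_eq_0)
  obtain S where S: "(Polynomial.smult (of_nat t) B + h) ^ m - Polynomial.smult (of_nat t) B ^ m
      = (Polynomial.smult (of_nat t) B + h - Polynomial.smult (of_nat t) B) * S"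
    "degree S \<le> (m - 1) * n" "coeff S ((m - 1) * n) = of_nat m * of_nat (t * K) ^ (m - 1)"
    using power_diff_factor[OF B'(1) tB(1) B'(2) tB(2) assms(3)] by blast
  have eq: "Polynomial.smult (of_nat (t * K) ^ m) A - (Polynomial.smult (of_nat t) B + h) ^ m
      = Polynomial.smult (of_nat t ^ m) (Polynomial.smult (of_nat K ^ m) A - B ^ m) - h * S"
    using S(1) by (simp add: smult_diff_right power_mult_distrib smult_power algebra_simps)
  have "coeff (Polynomial.smult (of_nat (t * K) ^ m) A - (Polynomial.smult (of_nat t) B + h) ^ m) l = 0"
    if l: "l + Suc j \<ge> m * n" for l
  proof (cases "l = l0")
    case True
    have "coeff (h * S) l0 = e * (of_nat m * of_nat (t * K) ^ (m - 1))"
      unfolding l0 using coeff_mult_top[OF h S(2)] S(3) by (simp add: h_def)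
    moreover have "of_nat t ^ m * e = e * (of_nat m * of_nat (t * K) ^ (m - 1))"
    proof -
      have "of_nat t ^ m = (of_nat t * of_nat t ^ (m - 1) :: 'a)" using assms(3) by (cases m) auto
      also have "of_nat t = (of_nat m * of_nat K ^ (m - 1) :: 'a)" by (simp add: t_def)
      finally have "of_nat t ^ m = (of_nat m * of_nat K ^ (m - 1) * of_nat t ^ (m - 1) :: 'a)"
        by (simp add: t_def)
      then show ?thesis by (simp add: power_mult_distrib mult_ac)
    qed
    ultimately show ?thesis unfolding eq True by (simp add: e_def)
  next
    case False
    then have "l > l0" using l by (simp add: l0_def)
    moreover have "degree (h * S) \<le> l0" using degree_mult_le[of h S] h S(2) l0 by linarith
    moreover have "coeff (Polynomial.smult (of_nat K ^ m) A - B ^ m) l = 0"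
      using \<open>l > l0\<close> by (intro B) (simp add: l0_def)
    ultimately show ?thesis unfolding eq by (simp add: coeff_eq_0)
  qed
  moreover have "t * K > 0" using K assms(3) by (simp add: t_def)
  ultimately show ?case using B' by blast
qed

text \<open>
  The approximate root agrees with the true root in every specialisation, so it is a root of \<open>K\<^sup>m A\<close>.
  Then \<open>K\<^sup>m\<close> divides \<open>B\<^sup>m\<close>, and \<open>K\<close> divides \<open>B\<close> because the polynomial ring is factorial.
\<close>

lemma monic_root_exists:
  fixes A :: "int poly poly"
  assumes monic: "lead_coeff A = 1" and m: "m > 0"
    and root: "\<And>c. norm c > R \<Longrightarrow> \<exists>q. lead_coeff q = 1 \<and> map_poly (spec c) A = q ^ m"
  shows "\<exists>\<delta>. lead_coeff \<delta> = 1 \<and> \<delta> ^ m = A"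
proof -
  have deg: "degree A = m * degree q" if "lead_coeff q = 1" "map_poly (spec c) A = q ^ m" for c q
  proof -
    have "degree (map_poly (spec c) A) = m * degree q"
      unfolding that(2) using that(1) by (rule degree_power_monic)
    then show ?thesis using degree_map_poly_spec_monic[OF monic] by simp
  qed
  obtain c0 :: complex where "norm c0 > R" using infinite_norm_gt[of R, THEN not_finite_existsD] by auto
  then obtain n where n: "degree A = m * n" using root deg by blast
  obtain K :: nat and B where K: "K > 0" "degree B \<le> n" "coeff B n = of_nat K"
    and B: "\<And>l. l + n \<ge> m * n \<Longrightarrow> coeff (Polynomial.smult (of_nat K ^ m) A - B ^ m) l = 0"
    using approximate_root[OF n monic m order_refl] by blast
  have mn: "m * n = (m - 1) * n + n" using m by (cases m) auto
  have "map_poly (spec c) (Polynomial.smult (of_nat K ^ m) A - B ^ m) = 0" if c: "norm c > R" for c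
  proof -
    obtain q where q: "lead_coeff q = 1" "map_poly (spec c) A = q ^ m" using root[OF c] by blast
    have dq: "degree q = n" using deg[OF q] n m by simp
    have diff: "map_poly (spec c) (Polynomial.smult (of_nat K ^ m) A - B ^ m)
        = Polynomial.smult (of_nat K) q ^ m - map_poly (spec c) B ^ m"
      by (simp add: hom_distribs q(2) smult_power)
    have "Polynomial.smult (of_nat K) q = map_poly (spec c) B"
    proof (rule power_eq_imp_eq_same_lead[of _ n _ "of_nat K" m])
      show "degree (map_poly (spec c) B) \<le> n" using K(2) degree_map_poly_le order_trans by blast
      show "coeff (Polynomial.smult (of_nat K) q ^ m - map_poly (spec c) B ^ m) l = 0" if "l \<ge> (m - 1) * n" for l
        unfolding diff[symmetric] using B[of l] that mn by simp
    qed (use K q dq m in auto)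
    then show ?thesis unfolding diff by simp
  qed
  then have "Polynomial.smult (of_nat K ^ m) A - B ^ m = 0" by (rule map_poly_spec_eq_0)
  then have BA: "B ^ m = of_nat K ^ m * A" by (simp add: of_nat_poly poly_const_pow)
  then have "of_nat K ^ m dvd B ^ m" by simp
  then have "of_nat K dvd B" using m by simp
  then obtain \<delta> where \<delta>: "B = of_nat K * \<delta>" by blast
  have K0: "(of_nat K :: int poly poly) \<noteq> 0" using K(1) by simp
  have "\<delta> ^ m = A" using BA K0 by (simp add: \<delta> power_mult_distrib)
  moreover have "lead_coeff \<delta> = 1"
  proof -
    have "of_nat K * coeff \<delta> n = (of_nat K :: int poly)" using K(3) by (simp add: \<delta> of_nat_poly)
    then have "coeff \<delta> n = 1" using K(1) by simp
    moreover have "degree \<delta> \<le> n" using K(1,2) by (simp add: \<delta> of_nat_poly)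
    ultimately show ?thesis by (metis le_antisym le_degree zero_neq_one)
  qed
  ultimately show ?thesis by blast
qed

section \<open>Moebius inversion\<close>

lemma moebius_prime_mult:
  assumes "prime p" "\<not> p dvd k" "k > 0"
  shows "moebius (p * k) = - moebius k"
proof -
  have cop: "coprime p k" using assms prime_imp_coprime by blast
  have "prime_factors (p * k) = insert p (prime_factors k)"
    using assms prime_gt_0_nat[of p] by (simp add: prime_factors_product prime_prime_factors)
  moreover have "p \<notin> prime_factors k" using assms by auto
  moreover have "squarefree (p * k) \<longleftrightarrow> squarefree k"
    using squarefree_multD(2) squarefree_mult_coprime[OF cop squarefree_prime[OF assms(1)]] by blast
  ultimately show ?thesis by (simp add: moebius_def)
qed

text \<open>
  For a prime \<open>p\<close> dividing \<open>n\<close>, the squarefree divisors pair off as \<open>k\<close> and \<open>p k\<close> with \<open>p\<close> not dividing \<open>k\<close>,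
  and the two terms of a pair cancel.
\<close>

lemma sum_moebius:
  assumes n: "n > 0"
  shows "(\<Sum>k | k dvd n. moebius k) = (if n = 1 then 1 else 0)"
proof (cases "n = 1")
  case True
  then have "{k. k dvd n} = {1}" by auto
  then show ?thesis using True by (simp add: moebius_def)
next
  case False
  then obtain p where p: "prime p" "p dvd n" using prime_factor_nat by blast
  let ?A = "{k. k dvd n \<and> \<not> p dvd k}"
  let ?B = "{k. k dvd n \<and> p dvd k \<and> squarefree k}"
  have fin: "finite {k. k dvd n}" using n by simp
  have finA: "finite ?A" and finB: "finite {k. k dvd n \<and> p dvd k}" using fin by (auto elim: rev_finite_subset)
  have "(\<Sum>k | k dvd n. moebius k) = (\<Sum>k\<in>?A. moebius k) + (\<Sum>k | k dvd n \<and> p dvd k. moebius k)"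
    by (subst sum.union_disjoint[symmetric]) (use finA finB in \<open>auto intro!: sum.cong\<close>)
  also have "(\<Sum>k | k dvd n \<and> p dvd k. moebius k) = (\<Sum>k\<in>?B. moebius k)"
    using finB by (intro sum.mono_neutral_right) (auto simp: moebius_def)
  also have "\<dots> = (\<Sum>k\<in>{k \<in> ?A. squarefree k}. moebius (p * k))"
  proof (rule sum.reindex_bij_witness[of _ "\<lambda>k. p * k" "\<lambda>k. k div p"])
    fix k assume k: "k \<in> ?B"
    then obtain l where l: "k = p * l" by auto
    have "\<not> p dvd l"
    proof
      assume "p dvd l"
      then have "p\<^sup>2 dvd k" using l by (auto simp: power2_eq_square)
      then have "p dvd 1" using squarefreeD k by blast
      then show False using p(1) by auto
    qed
    moreover have "squarefree l" using k l squarefree_multD(2)[of p l] by auto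
    moreover have "l dvd n" using k l dvd_mult_right by blast
    ultimately show "k div p \<in> {k \<in> ?A. squarefree k}" "p * (k div p) = k"
      "moebius (p * (k div p)) = moebius k"
      using l p prime_gt_0_nat by auto
  next
    fix k assume k: "k \<in> {k \<in> ?A. squarefree k}"
    then have cop: "coprime p k" using p prime_imp_coprime by blast
    then have "p * k dvd n" using k p by (auto intro: divides_mult)
    moreover have "squarefree (p * k)" using cop k p squarefree_prime[of p] by (auto intro: squarefree_mult_coprime)
    ultimately show "p * k \<in> ?B" "p * k div p = k" using p prime_gt_0_nat by auto
  qed
  also have "\<dots> = (\<Sum>k\<in>{k \<in> ?A. squarefree k}. - moebius k)"
    using n p by (intro sum.cong refl moebius_prime_mult) (auto intro: dvd_pos_nat)
  also have "\<dots> = (\<Sum>k\<in>?A. - moebius k)"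
    using finA by (intro sum.mono_neutral_left) (auto simp: moebius_def)
  finally show ?thesis using False by (simp add: sum_negf)
qed

section \<open>Iterates as polynomials\<close>

lemma eval2_pcompose: "eval2 (pcompose p q) u v = eval2 p u (eval2 q u v)"
  by (induction p) (simp_all add: pcompose_pCons hom_distribs)

lemma eval2_iter: "eval2 (ftilde_iter d k) c z = (fmap d c ^^ k) z"
proof (induction k)
  case (Suc k)
  have "eval2 (ftilde d) c w = fmap d c w" for w
    unfolding ftilde_def Let_def
    by (simp only: eval2.hom_add eval2.hom_mult eval2.hom_minus eval2.hom_power) (simp add: fmap_def)
  then show ?case using Suc by (simp add: ftilde_iter_def eval2_pcompose)
qed (simp add: ftilde_iter_def)

lemma eval2_smult: "eval2 (Polynomial.smult a p) u v = spec u a * eval2 p u v"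
proof -
  have "Polynomial.smult a p = [:a:] * p" by simp
  then show ?thesis by (simp only: eval2.hom_mult) simp
qed

lemma eval2_pderiv_ftilde:
  assumes "d \<ge> 1" shows "eval2 (pderiv (ftilde d)) c z = slope d c (of_nat d) z"
proof -
  let ?z = "[:0, 1:] :: int poly poly" and ?c = "[:[:0, 1:]:] :: int poly poly"
  have "pderiv (?z ^ d) = Polynomial.smult (of_nat d) (?z ^ (d - 1))"
    by (simp add: pderiv_power pderiv_pCons)
  moreover have "pderiv (?z - ?c) = 1" by (simp add: pderiv_pCons)
  moreover have "pderiv ?c = 0" by (simp add: pderiv_pCons)
  ultimately have "pderiv (ftilde d) = (?z - ?c) * Polynomial.smult (of_nat d) (?z ^ (d - 1)) + ?z ^ d"
    unfolding ftilde_def Let_def by (simp only: pderiv_add pderiv_mult mult_1_right add_0_right)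
  then have "eval2 (pderiv (ftilde d)) c z = (z - c) * (of_nat d * z ^ (d - 1)) + z ^ d"
    by (simp add: hom_distribs eval2_smult del: mult_pCons_left mult_pCons_right mult_smult_left mult_smult_right)
  moreover have "z ^ d = z ^ (d - 1) * z" using assms by (cases d) auto
  ultimately show ?thesis by (simp add: slope_def algebra_simps)
qed

lemma eval2_pderiv_iter:
  assumes "d \<ge> 1" shows "eval2 (pderiv (ftilde_iter d k)) c z = cycle_slope d c (of_nat d) k z"
proof (induction k)
  case (Suc k)
  have "ftilde_iter d (Suc k) = pcompose (ftilde d) (ftilde_iter d k)" by (simp add: ftilde_iter_def)
  then show ?case using Suc assms
    by (simp add: pderiv_pcompose hom_distribs eval2_pcompose eval2_iter eval2_pderiv_ftilde
        cycle_slope_def mult.commute)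
qed (simp add: ftilde_iter_def cycle_slope_def pderiv_pCons)

lemma ftilde_monic:
  assumes "d \<ge> 1" shows "degree (ftilde d) = d + 1" "lead_coeff (ftilde d) = 1"
proof -
  let ?l = "[:0, 1:] - [:[:0, 1:]:] :: int poly poly" and ?z = "[:0, 1:] :: int poly poly"
  let ?p = "?l * ?z ^ d"
  have l: "degree ?l = 1" "lead_coeff ?l = 1" by simp_all
  have z: "degree (?z ^ d) = d" "lead_coeff (?z ^ d) = 1"
    by (simp add: degree_power_monic) (subst lead_coeff_power, simp)
  have "?l \<noteq> 0" "?z ^ d \<noteq> 0" using l z by auto
  then have "degree ?p = degree ?l + degree (?z ^ d)" by (rule degree_mult_eq)
  then have "degree ?p = 1 + d" by (simp only: l z)
  moreover have "lead_coeff ?p = 1" unfolding lead_coeff_mult l(2) z(2) by (rule mult_1)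
  ultimately have p: "degree ?p = d + 1" "lead_coeff ?p = 1" by (simp_all only: add.commute)
  have lt: "degree ([:[:0, 1:]:] :: int poly poly) < degree ?p" unfolding p by simp
  show "degree (ftilde d) = d + 1"
    unfolding ftilde_def Let_def degree_add_eq_left[OF lt] by (rule p)
  show "lead_coeff (ftilde d) = 1"
    unfolding ftilde_def Let_def by (subst (1 2) add.commute) (simp only: lead_coeff_add_le[OF lt] p(2))
qed

lemma iter_monic:
  assumes "d \<ge> 1"
  shows "degree (ftilde_iter d k) = (d + 1) ^ k" "lead_coeff (ftilde_iter d k) = 1"
proof -
  have "degree (ftilde_iter d k) = (d + 1) ^ k \<and> lead_coeff (ftilde_iter d k) = 1"
  proof (induction k)
    case (Suc k)
    have e: "ftilde_iter d (Suc k) = pcompose (ftilde d) (ftilde_iter d k)" by (simp add: ftilde_iter_def)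
    have "degree (ftilde_iter d k) > 0" using Suc by simp
    moreover have "lead_coeff (ftilde_iter d k) = 1" using Suc by blast
    ultimately have "lead_coeff (ftilde_iter d (Suc k)) = 1"
      unfolding e using ftilde_monic(2)[OF assms] by (simp only: lead_coeff_comp power_one mult_1)
    moreover have "degree (ftilde_iter d (Suc k)) = (d + 1) ^ Suc k"
      unfolding e degree_pcompose using Suc ftilde_monic(1)[OF assms] by simp
    ultimately show ?case by blast
  qed (simp add: ftilde_iter_def)
  then show "degree (ftilde_iter d k) = (d + 1) ^ k" "lead_coeff (ftilde_iter d k) = 1" by auto
qed

definition fixpoly :: "nat \<Rightarrow> nat \<Rightarrow> int poly poly" where
  "fixpoly d k = ftilde_iter d k - [:0, 1:]"

lemma fixpoly_monic:
  assumes "d \<ge> 1" "k > 0"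
  shows "degree (fixpoly d k) = (d + 1) ^ k" "lead_coeff (fixpoly d k) = 1"
proof -
  have "(d + 1) ^ 1 \<le> (d + 1) ^ k" using assms by (intro power_increasing) auto
  then have gt: "degree (- [:0, 1:] :: int poly poly) < degree (ftilde_iter d k)"
    using assms by (simp add: iter_monic(1))
  have e: "fixpoly d k = ftilde_iter d k + - [:0, 1:]" by (simp add: fixpoly_def)
  show deg: "degree (fixpoly d k) = (d + 1) ^ k"
    unfolding e degree_add_eq_left[OF gt] using assms by (simp add: iter_monic)
  have "coeff (- [:0, 1:] :: int poly poly) (degree (ftilde_iter d k)) = 0"
    using gt by (rule coeff_eq_0)
  then show "lead_coeff (fixpoly d k) = 1"
    unfolding deg using iter_monic[OF assms(1), of k] by (simp add: e)
qed

lemma poly_spec_fixpoly: "poly (map_poly (spec c) (fixpoly d k)) z = (fmap d c ^^ k) z - z"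
  using eval2_iter[of d k c z] by (simp add: fixpoly_def hom_distribs eval2_def[symmetric])

section \<open>Fixed points of iterates as simple roots\<close>

definition root_poly :: "complex set \<Rightarrow> complex poly" where
  "root_poly A = (\<Prod>z\<in>A. [:-z, 1:])"

lemma root_poly_monic: "lead_coeff (root_poly A) = 1"
  by (simp add: root_poly_def lead_coeff_prod)

lemma degree_root_poly: "degree (root_poly A) = card A"
  unfolding root_poly_def by (subst degree_prod_eq_sum_degree) auto

lemma root_poly_nonzero [simp]: "root_poly A \<noteq> 0"
  using root_poly_monic[of A] by auto

lemma root_poly_UN:
  assumes "finite I" "\<And>i. i \<in> I \<Longrightarrow> finite (A i)"
    "\<And>i j. i \<in> I \<Longrightarrow> j \<in> I \<Longrightarrow> i \<noteq> j \<Longrightarrow> A i \<inter> A j = {}"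
  shows "root_poly (\<Union>i\<in>I. A i) = (\<Prod>i\<in>I. root_poly (A i))"
  unfolding root_poly_def using assms by (intro prod.UNION_disjoint) auto

text \<open>
  Beyond this modulus of the parameter all multipliers have modulus greater than 1.
\<close>

definition radius :: "nat \<Rightarrow> real" where "radius d = 8 * (real d + 1)"

text \<open>
  A multiple root would be a fixed point of the iterate with multiplier 1.
\<close>

lemma spec_fixpoly:
  assumes d: "d \<ge> 1" and c: "norm c > radius d" and k: "k > 0"
  shows "map_poly (spec c) (fixpoly d k) = root_poly (fixpts d c k)"
    "finite (fixpts d c k)" "card (fixpts d c k) = (d + 1) ^ k"
proof -
  let ?p = "map_poly (spec c) (fixpoly d k)"
  have monic: "lead_coeff ?p = 1" "degree ?p = (d + 1) ^ k"
    using degree_map_poly_spec_monic[OF fixpoly_monic(2)[OF d k]] fixpoly_monic(1)[OF d k] by auto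
  have root: "poly ?p z = 0 \<longleftrightarrow> z \<in> fixpts d c k" for z
    by (simp add: poly_spec_fixpoly fixpts_def)
  have "poly (pderiv ?p) z \<noteq> 0" if "z \<in> fixpts d c k" for z
  proof -
    have "poly (pderiv ?p) z = eval2 (pderiv (fixpoly d k)) c z"
      by (simp add: eval2_def hom_distribs)
    also have "\<dots> = cycle_slope d c (of_nat d) k z - 1"
      by (simp add: fixpoly_def pderiv_diff pderiv_pCons hom_distribs eval2_pderiv_iter[OF d])
    finally show ?thesis
      using norm_cycle_slope_gt_1[OF d c[unfolded radius_def] k that] by auto
  qed
  then have "rsquarefree ?p" using root by (auto simp: rsquarefree_roots)
  from complex_poly_decompose_rsquarefree[OF this] monic root
  show eq: "?p = root_poly (fixpts d c k)" by (simp add: root_poly_def)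
  show "card (fixpts d c k) = (d + 1) ^ k" using monic(2) unfolding eq degree_root_poly .
  then show "finite (fixpts d c k)" by (intro card_ge_0_finite) simp
qed

lemma finite_primpts:
  assumes "d \<ge> 1" "norm c > radius d" "k > 0" shows "finite (primpts d c k)"
  by (rule finite_subset[OF _ spec_fixpoly(2)[OF assms]]) (auto simp: primpts_def)

section \<open>Dynatomic polynomials\<close>

lemma monic_division:
  fixes A B :: "'a :: idom poly"
  assumes "lead_coeff A = 1"
  obtains q r where "B = A * q + r" "r = 0 \<or> degree r < degree A"
proof -
  obtain q r where qr: "pseudo_divmod B A = (q, r)" by (cases "pseudo_divmod B A") auto
  have "A \<noteq> 0" using assms by auto
  from pseudo_divmod[OF this qr] assms show ?thesis by (intro that[of q r]) auto
qed

text \<open>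
  Division by a monic polynomial commutes with specialisation, and the remainder vanishes in infinitely
  many specialisations.
\<close>

lemma monic_dvd_if_spec_dvd:
  assumes A: "lead_coeff A = 1"
    and dvd: "\<And>c. norm c > R \<Longrightarrow> map_poly (spec c) A dvd map_poly (spec c) B"
  shows "A dvd B"
proof -
  obtain q r where qr: "B = A * q + r" "r = 0 \<or> degree r < degree A" by (rule monic_division[OF A])
  have "r = 0"
  proof (rule ccontr)
    assume r0: "r \<noteq> 0"
    have "map_poly (spec c) r = 0" if c: "norm c > R" for c
    proof (rule ccontr)
      assume ne: "map_poly (spec c) r \<noteq> 0"
      have "map_poly (spec c) A dvd map_poly (spec c) r"
      proof -
        have "map_poly (spec c) B = map_poly (spec c) A * map_poly (spec c) q + map_poly (spec c) r"
          unfolding qr(1) by (simp only: spec_poly.hom_add spec_poly.hom_mult)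
        then show ?thesis using dvd[OF c] by (simp only: dvd_add_right_iff[OF dvd_triv_left])
      qed
      then have "degree (map_poly (spec c) A) \<le> degree (map_poly (spec c) r)"
        using ne by (rule dvd_imp_degree_le)
      then show False
        using degree_map_poly_spec_monic(1)[OF A, of c] degree_map_poly_le[of "spec c" r] qr(2) r0 by simp
    qed
    then show False using map_poly_spec_eq_0[of R r] r0 by blast
  qed
  then show ?thesis using qr(1) by simp
qed

text \<open>
  The factors that belong to the proper divisors \<open>k\<close> of \<open>n\<close> have pairwise disjoint sets of simple roots, all
  of them fixed by the \<open>n\<close>-th iterate. So their product divides \<open>f\<^sup>n(z) - z\<close> in every specialisation, and
  the quotient collects the points of exact period \<open>n\<close>.
\<close>

lemma exists_primitive_factor:
  assumes d: "d \<ge> 1" and n: "n > 0"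
  shows "\<exists>\<Phi>. lead_coeff \<Phi> = 1 \<and>
    (\<forall>c. norm c > radius d \<longrightarrow> map_poly (spec c) \<Phi> = root_poly (primpts d c n))"
  using n
proof (induction n rule: less_induct)
  case (less n)
  let ?D = "{k. k dvd n \<and> k \<noteq> n}"
  have D: "k > 0" "k < n" "k dvd n" if "k \<in> ?D" for k
    using that less.prems dvd_imp_le[of k n] dvd_pos_nat[of n k] by auto
  have finD: "finite ?D" by (rule finite_subset[of _ "{k. k dvd n}"]) (use less.prems in auto)
  have ex: "\<forall>k\<in>?D. \<exists>\<Phi>. lead_coeff \<Phi> = 1 \<and>
    (\<forall>c. norm c > radius d \<longrightarrow> map_poly (spec c) \<Phi> = root_poly (primpts d c k))"
    using less.IH D by blast
  obtain \<Phi> where "\<forall>k\<in>?D. lead_coeff (\<Phi> k) = 1 \<and>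
    (\<forall>c. norm c > radius d \<longrightarrow> map_poly (spec c) (\<Phi> k) = root_poly (primpts d c k))"
    using bchoice[OF ex] by blast
  then have \<Phi>: "\<And>k. k \<in> ?D \<Longrightarrow> lead_coeff (\<Phi> k) = 1"
    "\<And>k c. k \<in> ?D \<Longrightarrow> norm c > radius d \<Longrightarrow> map_poly (spec c) (\<Phi> k) = root_poly (primpts d c k)"
    by blast+
  define A where "A = (\<Prod>k\<in>?D. \<Phi> k)"
  have A: "lead_coeff A = 1" by (simp add: A_def lead_coeff_prod \<Phi>(1))
  have split: "map_poly (spec c) (fixpoly d n) = map_poly (spec c) A * root_poly (primpts d c n)"
    if c: "norm c > radius d" for c
  proof -
    let ?U = "\<Union>k\<in>?D. primpts d c k"
    have "map_poly (spec c) A = (\<Prod>k\<in>?D. root_poly (primpts d c k))"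
      by (simp add: A_def hom_distribs \<Phi>(2) c)
    also have "\<dots> = root_poly ?U"
      by (rule root_poly_UN[OF finD finite_primpts[OF d c D(1)] primpts_disjoint[OF D(1) D(1)], symmetric])
    finally have 1: "map_poly (spec c) A = root_poly ?U" .
    have "{k. k dvd n} = insert n ?D" by auto
    then have U: "fixpts d c n = ?U \<union> primpts d c n"
      using fixpts_Union_primpts[OF less.prems, of d c] by auto
    have "primpts d c k \<inter> primpts d c n = {}" if "k \<in> ?D" for k
      by (rule primpts_disjoint[OF D(1)[OF that] less.prems]) (use that in simp)
    then have "?U \<inter> primpts d c n = {}" by blast
    moreover have "finite ?U" using finD finite_primpts[OF d c D(1)] by (rule finite_UN_I)
    ultimately have "root_poly (fixpts d c n) = root_poly ?U * root_poly (primpts d c n)"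
      unfolding U root_poly_def by (intro prod.union_disjoint finite_primpts[OF d c less.prems])
    then show ?thesis using spec_fixpoly(1)[OF d c less.prems] 1 by simp
  qed
  have "A dvd fixpoly d n"
    by (rule monic_dvd_if_spec_dvd[OF A, of "radius d"]) (simp add: split)
  then obtain q where q: "fixpoly d n = A * q" by blast
  have "lead_coeff q = 1"
    using fixpoly_monic(2)[OF d less.prems] A unfolding q lead_coeff_mult by simp
  moreover have "map_poly (spec c) q = root_poly (primpts d c n)" if c: "norm c > radius d" for c
  proof -
    have "map_poly (spec c) A * map_poly (spec c) q = map_poly (spec c) A * root_poly (primpts d c n)"
      using split[OF c] unfolding q by (simp add: hom_distribs)
    moreover have "map_poly (spec c) A \<noteq> 0" using degree_map_poly_spec_monic(2)[OF A, of c] leading_coeff_0_iff zero_neq_one by metis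
    ultimately show ?thesis by simp
  qed
  ultimately show ?case by blast
qed

lemma power_int_sum_exponent:
  fixes x :: "'a :: field"
  assumes "x \<noteq> 0" shows "x powi (\<Sum>i\<in>I. f i) = (\<Prod>i\<in>I. x powi f i)"
  by (induction I rule: infinite_finite_induct) (simp_all add: power_int_add assms)

lemma prod_power_int:
  fixes x :: "'b \<Rightarrow> 'a :: field" shows "(\<Prod>i\<in>I. x i) powi e = (\<Prod>i\<in>I. x i powi e)"
  by (induction I rule: infinite_finite_induct) (simp_all add: power_int_mult_distrib)

text \<open>
  After exchanging the products, \<open>x j\<close> has the exponent \<open>\<Sum>moebius l\<close> over the divisors \<open>l\<close> of \<open>m div j\<close>.
\<close>

lemma moebius_inversion_prod:
  fixes x :: "nat \<Rightarrow> 'a :: field"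
  assumes m: "m > 0" and x: "\<And>j. j dvd m \<Longrightarrow> x j \<noteq> 0"
  shows "(\<Prod>k | k dvd m. (\<Prod>j | j dvd k. x j) powi moebius (m div k)) = x m"
proof -
  let ?D = "{k. k dvd m}"
  let ?t = "\<lambda>j k. if j dvd k then x j powi moebius (m div k) else 1"
  have fin: "finite ?D" using m by simp
  have "(\<Prod>k\<in>?D. (\<Prod>j | j dvd k. x j) powi moebius (m div k)) = (\<Prod>k\<in>?D. \<Prod>j\<in>?D. ?t j k)"
  proof (intro prod.cong refl)
    fix k assume k: "k \<in> ?D"
    have "(\<Prod>j | j dvd k. x j) powi moebius (m div k) = (\<Prod>j\<in>{j. j dvd k}. ?t j k)"
      unfolding prod_power_int by (intro prod.cong) auto
    also have "\<dots> = (\<Prod>j\<in>?D. ?t j k)"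
      using fin k by (intro prod.mono_neutral_left) (auto intro: dvd_trans)
    finally show "(\<Prod>j | j dvd k. x j) powi moebius (m div k) = (\<Prod>j\<in>?D. ?t j k)" .
  qed
  also have "\<dots> = (\<Prod>j\<in>?D. \<Prod>k\<in>?D. ?t j k)" by (rule prod.swap)
  also have "\<dots> = (\<Prod>j\<in>?D. if j = m then x m else 1)"
  proof (intro prod.cong refl)
    fix j assume "j \<in> ?D"
    then have j: "j dvd m" by simp
    then have j0: "j > 0" "m div j > 0" using m dvd_imp_le[of j m] dvd_pos_nat[of m j] by (auto simp: div_greater_zero_iff)
    have "(\<Prod>k\<in>?D. ?t j k) = (\<Prod>k\<in>{k \<in> ?D. j dvd k}. x j powi moebius (m div k))"
      by (rule prod.inter_filter[OF fin, symmetric])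
    also have "\<dots> = (\<Prod>l | l dvd m div j. x j powi moebius l)"
    proof (rule prod.reindex_bij_witness[of _ "\<lambda>l. m div l" "\<lambda>k. m div k"])
      fix k assume "k \<in> {k \<in> ?D. j dvd k}"
      then obtain a b where a: "k = j * a" and b: "m = k * b" by (auto elim!: dvdE)
      have "k > 0" "b > 0" using m b by auto
      then show "m div (m div k) = k" "m div k \<in> {l. l dvd m div j}"
        "x j powi moebius (m div k) = x j powi moebius (m div k)"
        using a b j0 by (auto simp: mult.assoc)
    next
      fix l assume "l \<in> {l. l dvd m div j}"
      then obtain a where "m div j = l * a" by auto
      then have a: "m = j * (l * a)" using j by (metis dvd_mult_div_cancel)
      then have "l > 0" "a > 0" using m by auto
      moreover have "m = l * (j * a)" using a by (simp add: mult_ac)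
      ultimately show "m div (m div l) = l" "m div l \<in> {k \<in> ?D. j dvd k}"
        using j0 by (auto simp: dvd_def)
    qed
    also have "\<dots> = x j powi (\<Sum>l | l dvd m div j. moebius l)"
      by (rule power_int_sum_exponent[OF x[OF j], symmetric])
    also have "\<dots> = (if j = m then x m else 1)"
    proof -
      have "m div j = 1 \<longleftrightarrow> j = m" using j j0 m by auto
      then show ?thesis unfolding sum_moebius[OF j0(2)] by simp
    qed
    finally show "(\<Prod>k\<in>?D. ?t j k) = (if j = m then x m else 1)" .
  qed
  also have "\<dots> = x m" using fin by simp
  finally show ?thesis .
qed

lemma dynatomic_spec:
  assumes d: "d \<ge> 1" and m: "m > 0"
  shows "lead_coeff (dynatomic d m) = 1"
    "norm c > radius d \<Longrightarrow> map_poly (spec c) (dynatomic d m) = root_poly (primpts d c m)"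
proof -
  have ex: "\<forall>n\<in>{0<..}. \<exists>\<Phi>. lead_coeff \<Phi> = 1 \<and>
    (\<forall>c. norm c > radius d \<longrightarrow> map_poly (spec c) \<Phi> = root_poly (primpts d c n))"
    using exists_primitive_factor[OF d] by auto
  obtain \<Phi> where "\<forall>n\<in>{0<..}. lead_coeff (\<Phi> n) = 1 \<and>
    (\<forall>c. norm c > radius d \<longrightarrow> map_poly (spec c) (\<Phi> n) = root_poly (primpts d c n))"
    using bchoice[OF ex] by blast
  then have \<Phi>: "\<And>n. n > 0 \<Longrightarrow> lead_coeff (\<Phi> n) = 1"
    "\<And>n c. n > 0 \<Longrightarrow> norm c > radius d \<Longrightarrow> map_poly (spec c) (\<Phi> n) = root_poly (primpts d c n)"
    by auto
  have fac: "fixpoly d n = (\<Prod>k | k dvd n. \<Phi> k)" if n: "n > 0" for n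
  proof -
    have pos: "k > 0" if "k dvd n" for k using that n by (rule dvd_pos_nat[rotated])
    have "map_poly (spec c) (fixpoly d n - (\<Prod>k | k dvd n. \<Phi> k)) = 0" if c: "norm c > radius d" for c
    proof -
      have "root_poly (fixpts d c n) = (\<Prod>k | k dvd n. root_poly (primpts d c k))"
        unfolding fixpts_Union_primpts[OF n]
        by (rule root_poly_UN) (use n pos finite_primpts[OF d c] primpts_disjoint in \<open>simp_all\<close>)
      then show ?thesis
        using pos by (simp add: hom_distribs spec_fixpoly(1)[OF d c n] \<Phi>(2) c)
    qed
    then show ?thesis using map_poly_spec_eq_0 by (metis eq_iff_diff_eq_0)
  qed
  have to_fract_prod: "to_fract (\<Prod>k\<in>I. f k) = (\<Prod>k\<in>I. to_fract (f k))"
    for I and f :: "nat \<Rightarrow> int poly poly"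
    by (induction I rule: infinite_finite_induct) simp_all
  have "(\<Prod>k | k dvd m. to_fract (ftilde_iter d k - [:0, 1:]) powi moebius (m div k))
    = (\<Prod>k | k dvd m. (\<Prod>j | j dvd k. to_fract (\<Phi> j)) powi moebius (m div k))"
    using m by (intro prod.cong refl)
      (simp add: fixpoly_def[symmetric] fac dvd_pos_nat to_fract_prod)
  also have "\<dots> = to_fract (\<Phi> m)"
  proof (rule moebius_inversion_prod[OF m])
    fix j assume "j dvd m"
    then have "lead_coeff (\<Phi> j) = 1" using m by (intro \<Phi>(1)) (rule dvd_pos_nat)
    then show "to_fract (\<Phi> j) \<noteq> 0" by auto
  qed
  finally have "dynatomic d m = \<Phi> m" unfolding dynatomic_def by simp
  then show "lead_coeff (dynatomic d m) = 1"
    "norm c > radius d \<Longrightarrow> map_poly (spec c) (dynatomic d m) = root_poly (primpts d c m)"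
    using \<Phi> m by auto
qed

lemma card_primpts:
  assumes "d \<ge> 1" "m > 0" "norm c > radius d"
  shows "card (primpts d c m) = degree (dynatomic d m)"
  using dynatomic_spec[OF assms(1,2)] degree_map_poly_spec_monic(1)[of "dynatomic d m" c]
    degree_root_poly assms(3) by metis

section \<open>Counting the points near the centre\<close>

lemma coeff_mult_second:
  assumes "degree p \<le> Suc a" "degree q \<le> Suc b"
  shows "coeff (p * q) (Suc (a + b)) = coeff p (Suc a) * coeff q b + coeff p a * coeff q (Suc b)"
proof -
  have "coeff (p * q) (Suc (a + b)) = (\<Sum>i\<le>Suc (a + b). coeff p i * coeff q (Suc (a + b) - i))"
    by (rule coeff_mult)
  also have "\<dots> = (\<Sum>i\<in>{a, Suc a}. coeff p i * coeff q (Suc (a + b) - i))"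
  proof (intro sum.mono_neutral_right ballI)
    fix i assume "i \<in> {..Suc (a + b)} - {a, Suc a}"
    then have "i < a \<or> i > Suc a" by auto
    then show "coeff p i * coeff q (Suc (a + b) - i) = 0" using assms by (auto simp: coeff_eq_0)
  qed auto
  also have "\<dots> = coeff p (Suc a) * coeff q b + coeff p a * coeff q (Suc b)" by (simp add: add.commute Suc_diff_le)
  finally show ?thesis .
qed

lemma coeff_power_second:
  assumes "degree q \<le> Suc a" "coeff q (Suc a) = 1"
  shows "coeff (q ^ Suc e) (e * Suc a + a) = of_nat (Suc e) * coeff q a"
proof (induction e)
  case (Suc e)
  have deg: "degree (q ^ Suc e) \<le> Suc (e * Suc a + a)"
    and top: "coeff (q ^ Suc e) (Suc (e * Suc a + a)) = 1"
  proof -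
    have idx: "Suc (e * Suc a + a) = Suc e * Suc a" by simp
    show "degree (q ^ Suc e) \<le> Suc (e * Suc a + a)" "coeff (q ^ Suc e) (Suc (e * Suc a + a)) = 1"
      unfolding idx power_top(2)[OF assms(1)] assms(2)
      by (rule power_top(1)[OF assms(1)]) (rule power_one)
  qed
  have "coeff (q ^ Suc (Suc e)) (Suc e * Suc a + a) = coeff (q * q ^ Suc e) (Suc (a + (e * Suc a + a)))"
    by (simp add: add_ac)
  also have "\<dots> = coeff q (Suc a) * coeff (q ^ Suc e) (e * Suc a + a)
      + coeff q a * coeff (q ^ Suc e) (Suc (e * Suc a + a))"
    by (rule coeff_mult_second[OF assms(1) deg])
  also have "\<dots> = of_nat (Suc (Suc e)) * coeff q a"
    unfolding Suc.IH assms(2) top by (simp add: algebra_simps)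
  finally show ?case .
qed simp

text \<open>
  In \<open>f(q) = q\<^bsup>d+1\<^esup> - c q\<^sup>d + c\<close> with \<open>q\<close> monic of degree at least 2, only the first term reaches the second
  coefficient, which is therefore multiplied by \<open>d + 1\<close> in each step.
\<close>

lemma coeff_iter_second:
  assumes d: "d \<ge> 1"
  shows "coeff (ftilde_iter d (Suc k)) ((d + 1) ^ Suc k - 1) = [:0, - int ((d + 1) ^ k):]"
proof (induction k)
  case 0
  let ?z = "[:0, 1:] :: int poly poly" and ?c = "[:[:0, 1:]:] :: int poly poly"
  have "ftilde_iter d (Suc 0) = ?z ^ Suc d - ?c * ?z ^ d + ?c"
    by (simp add: ftilde_iter_def pcompose_idR ftilde_def Let_def algebra_simps)
  moreover have z: "?z = monom 1 1" by (simp add: monom_altdef)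
  ultimately show ?case using d unfolding z monom_power by (simp add: coeff_monom_mult coeff_pCons split: nat.split)
next
  case (Suc k)
  define q where "q = ftilde_iter d (Suc k)"
  define a where "a = (d + 1) ^ Suc k - 1"
  have Sa: "Suc a = (d + 1) ^ Suc k" by (simp add: a_def)
  have a1: "a \<ge> 1"
  proof -
    have "2 ^ 1 \<le> (d + 1) ^ 1" using d by simp
    also have "\<dots> \<le> (d + 1) ^ Suc k" by (intro power_increasing) auto
    finally show ?thesis by (simp add: a_def)
  qed
  have q: "degree q = Suc a" "coeff q (Suc a) = 1"
    using iter_monic[OF d, of "Suc k"] unfolding q_def[symmetric] Sa by auto
  have idx: "(d + 1) ^ Suc (Suc k) - 1 = d * Suc a + a" using Sa by (simp add: algebra_simps)
  have "ftilde_iter d (Suc (Suc k)) = pcompose (ftilde d) q" by (simp add: q_def ftilde_iter_def)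
  also have "\<dots> = q ^ Suc d - Polynomial.smult [:0, 1:] (q ^ d) + [:[:0, 1:]:]"
  proof -
    have "pcompose [:0, 1:] q = q" by (simp add: pcompose_pCons)
    then have "pcompose (ftilde d) q = (q - [:[:0, 1:]:]) * q ^ d + [:[:0, 1:]:]"
      unfolding ftilde_def Let_def
      by (simp only: pcompose_add pcompose_mult pcompose_diff pcompose_hom.hom_power pcompose_const)
    then show ?thesis by (simp add: algebra_simps)
  qed
  finally have e: "ftilde_iter d (Suc (Suc k)) = q ^ Suc d - Polynomial.smult [:0, 1:] (q ^ d) + [:[:0, 1:]:]" .
  have "degree (q ^ d) \<le> d * Suc a" by (rule power_top(1)) (simp add: q)
  then have "coeff (q ^ d) (d * Suc a + a) = 0" using a1 by (intro coeff_eq_0) simp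
  moreover have "coeff ([:[:0, 1:]:] :: int poly poly) (d * Suc a + a) = 0"
    using a1 by (intro coeff_eq_0) simp
  moreover have "coeff (q ^ Suc d) (d * Suc a + a) = of_nat (Suc d) * coeff q a"
    by (rule coeff_power_second) (simp_all add: q)
  moreover have "coeff q a = [:0, - int ((d + 1) ^ k):]" using Suc by (simp add: q_def a_def)
  ultimately show ?case unfolding idx e
    by (simp add: of_nat_poly del: power_Suc) (simp add: algebra_simps)
qed

lemma coeff_root_poly_second:
  assumes "finite A" "A \<noteq> {}" shows "coeff (root_poly A) (card A - 1) = - \<Sum>A"
  using assms
proof (induction A rule: finite_ne_induct)
  case (insert a A)
  obtain n where n: "card A = Suc n" using insert by (cases "card A") auto
  have "root_poly (insert a A) = [:-a, 1:] * root_poly A" using insert by (simp add: root_poly_def)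
  moreover have "coeff (root_poly A) (Suc n) = 1"
    using root_poly_monic[of A] unfolding degree_root_poly n .
  ultimately show ?case using insert n by simp
qed (simp add: root_poly_def)

text \<open>
  Minus the sum is the second coefficient of \<open>f\<^bsup>k+1\<^esup>(z) - z\<close>. The term \<open>-z\<close> reaches it only for \<open>d = 1\<close> and
  \<open>k = 0\<close>, which is the reason for the error 1.
\<close>

lemma sum_fixpts:
  assumes d: "d \<ge> 1" and c: "norm c > radius d"
  shows "norm (\<Sum>(fixpts d c (Suc k)) - of_nat ((d + 1) ^ k) * c) \<le> 1"
proof -
  let ?F = "fixpts d c (Suc k)" and ?n = "(d + 1) ^ Suc k - 1"
  note F = spec_fixpoly[OF d c zero_less_Suc[of k]]
  have neg: "S - a = b" if "- S = - a - b" for S a b :: complex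
  proof -
    have "S = - (- a - b)" unfolding that[symmetric] by simp
    then show ?thesis by simp
  qed
  have "?F \<noteq> {}" using F(3) by auto
  from coeff_root_poly_second[OF F(2) this]
  have "- \<Sum>?F = coeff (map_poly (spec c) (fixpoly d (Suc k))) ?n" unfolding F(1,3) by simp
  also have "\<dots> = spec c (coeff (fixpoly d (Suc k)) ?n)" by simp
  also have "\<dots> = spec c (coeff (ftilde_iter d (Suc k)) ?n) - spec c (coeff [:0, 1:] ?n)"
    by (simp only: fixpoly_def coeff_diff spec.hom_minus)
  also have "\<dots> = - (of_nat ((d + 1) ^ k) * c) - spec c (coeff [:0, 1:] ?n)"
    unfolding coeff_iter_second[OF d] by simp
  finally have "\<Sum>?F - of_nat ((d + 1) ^ k) * c = spec c (coeff [:0, 1:] ?n)"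
    by (rule neg)
  moreover have "coeff ([:0, 1:] :: int poly poly) i = (if i = 1 then 1 else 0)" for i
    by (auto simp: coeff_pCons split: nat.splits)
  ultimately show ?thesis by simp
qed

definition near :: "complex \<Rightarrow> complex set" where
  "near c = {z. norm (z - c) \<le> 4}"

text \<open>
  Beyond this modulus the sum of the fixed points of the \<open>n\<close>-th iterate determines how many of them are
  near \<open>c\<close>.
\<close>

definition near_radius :: "nat \<Rightarrow> nat \<Rightarrow> real" where
  "near_radius d n = radius d + 8 * (real d + 1) ^ n"

lemma near_radius_mono: "k \<le> n \<Longrightarrow> near_radius d k \<le> near_radius d n"
  unfolding near_radius_def by (intro add_left_mono mult_left_mono power_increasing) auto

lemma radius_less_near_radius: "radius d < near_radius d n"
  by (simp add: near_radius_def)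

text \<open>
  In the sum of all fixed points, those near \<open>c\<close> count \<open>c\<close> each and the others \<open>0\<close>, with an error of at
  most 4 per point. If the number of these points differed from \<open>(d + 1)\<^sup>k\<close>, the sum would be off by at least \<open>|c|\<close>.
\<close>

lemma card_near_fixpts:
  assumes d: "d \<ge> 1" and c: "norm c > near_radius d (Suc k)"
  shows "card (near c \<inter> fixpts d c (Suc k)) = (d + 1) ^ k"
proof -
  let ?F = "fixpts d c (Suc k)"
  let ?N = "near c \<inter> ?F"
  have c': "norm c > radius d" using c radius_less_near_radius[of d "Suc k"] by simp
  have c8: "norm c > 8" using c' by (simp add: radius_def)
  note F = spec_fixpoly[OF d c' zero_less_Suc[of k]]
  have "\<Sum>?F = \<Sum>?N + \<Sum>(?F - ?N)" using sum.subset_diff[of ?N ?F "\<lambda>z. z"] F(2) by (simp add: add.commute)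
  also have "\<Sum>?N = of_nat (card ?N) * c + (\<Sum>z\<in>?N. z - c)" by (simp add: sum_subtractf)
  finally have e: "(of_nat (card ?N) - of_nat ((d + 1) ^ k)) * c
      = (\<Sum>?F - of_nat ((d + 1) ^ k) * c) - ((\<Sum>z\<in>?N. z - c) + \<Sum>(?F - ?N))"
    by (simp add: algebra_simps)
  have "norm (\<Sum>z\<in>?N. z - c) \<le> (\<Sum>z\<in>?N. 4)" by (rule sum_norm_le) (simp add: near_def)
  moreover have "norm (\<Sum>(?F - ?N)) \<le> (\<Sum>z\<in>?F - ?N. 4)"
    using fixpts_dichotomy[OF d c8 zero_less_Suc] by (intro sum_norm_le) (fastforce simp: near_def)
  moreover have "(\<Sum>z\<in>?N. 4) + (\<Sum>z\<in>?F - ?N. 4) = (4 * real (card ?F))"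
    using sum.subset_diff[of ?N ?F "\<lambda>z. 4 :: real"] F(2) by simp
  ultimately have "norm ((of_nat (card ?N) - of_nat ((d + 1) ^ k)) * c) \<le> 1 + 4 * real (card ?F)"
    unfolding e using sum_fixpts[OF d c', of k]
      norm_triangle_ineq4[of "\<Sum>?F - of_nat ((d + 1) ^ k) * c" "(\<Sum>z\<in>?N. z - c) + \<Sum>(?F - ?N)"]
      norm_triangle_ineq[of "\<Sum>z\<in>?N. z - c" "\<Sum>(?F - ?N)"] by linarith
  also have "\<dots> < norm c"
  proof -
    have "real (card ?F) = (real d + 1) ^ Suc k" unfolding F(3) by (simp add: algebra_simps)
    moreover have "(real d + 1) ^ Suc k > 0" by (intro zero_less_power) simp
    ultimately show ?thesis using c unfolding near_radius_def radius_def
      by (simp only: distrib_left)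
  qed
  finally have "norm (of_nat (card ?N) - of_nat ((d + 1) ^ k) :: complex) * norm c < 1 * norm c"
    by (simp add: norm_mult)
  then have lt: "norm (of_nat (card ?N) - of_nat ((d + 1) ^ k) :: complex) < 1"
    using c8 by (subst (asm) mult_less_cancel_right_pos) auto
  have "(of_nat (card ?N) - of_nat ((d + 1) ^ k) :: complex) = of_int (int (card ?N) - int ((d + 1) ^ k))"
    by simp
  then have "norm (of_int (int (card ?N) - int ((d + 1) ^ k)) :: complex) < 1" using lt by metis
  then have "\<bar>int (card ?N) - int ((d + 1) ^ k)\<bar> < 1" unfolding norm_of_int by linarith
  then show ?thesis by linarith
qed

text \<open>
  Both sides, summed over the divisors of \<open>n\<close>, count fixed points of the \<open>n\<close>-th iterate; the proportion
  \<open>1 / (d + 1)\<close> passes from these sums to the summands by induction.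
\<close>

lemma card_near_primpts:
  assumes d: "d \<ge> 1" and n: "n > 0" and c: "norm c > near_radius d n"
  shows "(d + 1) * card (near c \<inter> primpts d c n) = card (primpts d c n)"
  using n c
proof (induction n rule: less_induct)
  case (less n)
  let ?D = "{k. k dvd n}" and ?p = "\<lambda>k. primpts d c k"
  have c': "norm c > radius d" using less.prems(2) radius_less_near_radius[of d n] by simp
  have pos: "k > 0" if "k \<in> ?D" for k using that less.prems(1) dvd_pos_nat[of n k] by simp
  have fin: "finite ?D" using less.prems(1) by simp
  have finp: "finite (?p k)" if "k \<in> ?D" for k by (rule finite_primpts[OF d c' pos[OF that]])
  have disj: "?p i \<inter> ?p j = {}" if "i \<in> ?D" "j \<in> ?D" "i \<noteq> j" for i j
    by (rule primpts_disjoint[OF pos[OF that(1)] pos[OF that(2)] that(3)])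
  obtain k where k: "n = Suc k" using less.prems(1) by (cases n) auto
  have "(\<Sum>j\<in>?D. card (?p j)) = card (fixpts d c n)"
    unfolding fixpts_Union_primpts[OF less.prems(1)]
    by (rule card_UN_disjoint[symmetric]) (use fin finp disj in blast)+
  also have "\<dots> = (d + 1) * (d + 1) ^ k" using spec_fixpoly(3)[OF d c' less.prems(1)] by (simp add: k)
  also have "(d + 1) ^ k = card (near c \<inter> fixpts d c n)"
    using card_near_fixpts[OF d, of k c] less.prems(2) by (simp add: k)
  also have "near c \<inter> fixpts d c n = (\<Union>j\<in>?D. near c \<inter> ?p j)"
    unfolding fixpts_Union_primpts[OF less.prems(1)] by blast
  also have "card \<dots> = (\<Sum>j\<in>?D. card (near c \<inter> ?p j))"
    by (rule card_UN_disjoint) (use fin finp disj in blast)+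
  finally have eq: "(\<Sum>j\<in>?D. card (?p j)) = (\<Sum>j\<in>?D. (d + 1) * card (near c \<inter> ?p j))"
    by (simp add: sum_distrib_left)
  have "(\<Sum>j\<in>?D - {n}. card (?p j)) = (\<Sum>j\<in>?D - {n}. (d + 1) * card (near c \<inter> ?p j))"
  proof (intro sum.cong refl)
    fix j assume j: "j \<in> ?D - {n}"
    then have "j \<le> n" "j \<noteq> n" using less.prems(1) by (auto dest: dvd_imp_le)
    then show "card (?p j) = (d + 1) * card (near c \<inter> ?p j)"
      using less.IH[of j] j pos near_radius_mono[of j n d] less.prems(2) by simp
  qed
  then show ?case using eq sum.remove[OF fin, of n "\<lambda>j. card (?p j)"]
      sum.remove[OF fin, of n "\<lambda>j. (d + 1) * card (near c \<inter> ?p j)"] by simp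
qed

section \<open>Size of the resultant\<close>

text \<open>
  The sum over \<open>z\<close> and \<open>i\<close> is taken in the other order: each \<open>f\<^sup>i\<close> permutes \<open>X\<close>.
\<close>

lemma sum_card_visits:
  assumes "finite X" "\<And>i. bij_betw (f ^^ i) X X"
  shows "(\<Sum>z\<in>X. card {i \<in> {..<m}. (f ^^ i) z \<in> S}) = m * card (S \<inter> X)"
proof -
  have "(\<Sum>z\<in>X. card {i \<in> {..<m}. (f ^^ i) z \<in> S})
      = (\<Sum>z\<in>X. \<Sum>i<m. if (f ^^ i) z \<in> S then 1 else 0)"
    by (simp add: sum.If_cases Int_def)
  also have "\<dots> = (\<Sum>i<m. \<Sum>z\<in>X. if (f ^^ i) z \<in> S then 1 else 0)" by (rule sum.swap)
  also have "\<dots> = (\<Sum>i<m. \<Sum>z\<in>X. if z \<in> S then 1 else 0)"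
    by (intro sum.cong refl sum.reindex_bij_betw[OF assms(2)])
  also have "(\<Sum>z\<in>X. if z \<in> S then 1 else (0::nat)) = card (S \<inter> X)"
    using assms(1) by (simp add: sum.If_cases Int_commute)
  finally show ?thesis by simp
qed

text \<open>
  The exponent of \<open>c\<close> that the factors near \<open>c\<close> contribute to the multiplier. The fixed point \<open>c\<close>
  makes one visit (\<open>m = 1\<close>), but its multiplier is \<open>c\<^sup>d\<close>, whence the additional \<open>d - 1\<close>.
\<close>

definition near_visits :: "nat \<Rightarrow> complex \<Rightarrow> nat \<Rightarrow> complex \<Rightarrow> nat" where
  "near_visits d c m z = card {i \<in> {..<m}. (fmap d c ^^ i) z \<in> near c} + (if z = c then d - 1 else 0)"

definition far_visits :: "nat \<Rightarrow> complex \<Rightarrow> nat \<Rightarrow> complex \<Rightarrow> nat" where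
  "far_visits d c m z = card {i \<in> {..<m}. (fmap d c ^^ i) z \<in> - near c}"

lemma center_primpts: "d \<ge> 1 \<Longrightarrow> m > 0 \<Longrightarrow> c \<in> primpts d c m \<longleftrightarrow> m = 1"
proof -
  assume d: "d \<ge> 1" and m: "m > 0"
  have c: "c \<in> fixpts d c k" for k using funpow_center[of d k c] d by (simp add: fixpts_def)
  show ?thesis
  proof
    assume "c \<in> primpts d c m"
    then have "m dvd 1" using primpts_dvd[OF _ c m] by blast
    then show "m = 1" by simp
  qed (use c in \<open>auto simp: primpts_def\<close>)
qed

lemma sum_visits:
  assumes d: "d \<ge> 1" and m: "m > 0" and c: "norm c > near_radius d m"
  defines "N \<equiv> card (near c \<inter> primpts d c m)"
  shows "(\<Sum>z\<in>primpts d c m. near_visits d c m z) = m * ((d - 1) * (if m = 1 then 1 else 0) + N)"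
    and "(\<Sum>z\<in>primpts d c m. far_visits d c m z) = m * (d * N)"
proof -
  let ?X = "primpts d c m"
  have c': "norm c > radius d" using c radius_less_near_radius[of d m] by simp
  have fin: "finite ?X" by (rule finite_primpts[OF d c' m])
  note bij = finite_bij_funpow_primpts[OF m fin]
  have "(\<Sum>z\<in>?X. if z = c then d - 1 else 0) = (if m = 1 then d - 1 else 0)"
    using fin center_primpts[OF d m, of c] by (simp add: sum.delta)
  then show "(\<Sum>z\<in>?X. near_visits d c m z) = m * ((d - 1) * (if m = 1 then 1 else 0) + N)"
    unfolding near_visits_def sum.distrib sum_card_visits[OF fin bij] N_def[symmetric] by simp
  have "card ?X = card (near c \<inter> ?X) + card (- near c \<inter> ?X)"
    using fin by (subst card_Un_disjoint[symmetric]) (auto intro: arg_cong[of _ _ card])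
  then have "card (- near c \<inter> ?X) = d * N" using card_near_primpts[OF d m c] by (simp add: N_def)
  then show "(\<Sum>z\<in>?X. far_visits d c m z) = m * (d * N)"
    unfolding far_visits_def sum_card_visits[OF fin bij] by simp
qed

text \<open>
  \<open>A\<close> and \<open>B\<close> bound the factors near \<open>c\<close> and near \<open>0\<close> from above, \<open>A'\<close> and \<open>B'\<close> from below.
\<close>

lemma cycle_slope_bounds:
  assumes d: "d \<ge> 1" and m: "m > 0" and c: "norm c > 8" and z: "z \<in> primpts d c m"
    and K: "norm (1 + D) \<le> K"
  shows "norm c + 4 * K \<le> A \<Longrightarrow> norm D * norm c + 4 * K \<le> B \<Longrightarrow>
      norm (cycle_slope d c D m z) \<le> A ^ near_visits d c m z * B ^ far_visits d c m z"
    and "0 \<le> A' \<Longrightarrow> 0 \<le> B' \<Longrightarrow> A' \<le> norm c - 4 * K \<Longrightarrow> B' \<le> norm D * norm c - 4 * K \<Longrightarrow>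
      A' ^ near_visits d c m z * B' ^ far_visits d c m z \<le> norm (cycle_slope d c D m z)"
proof -
  have K0: "K \<ge> 0" using K norm_ge_zero order_trans by blast
  have zf: "z \<in> fixpts d c m" using z by (simp add: primpts_def)
  let ?w = "\<lambda>i. (fmap d c ^^ i) z"
  let ?a = "\<lambda>a b i. if ?w i \<in> near c then a else b :: real"
  have prod: "(\<Prod>i<m. ?a a b i) = a ^ card {i \<in> {..<m}. ?w i \<in> near c} * b ^ far_visits d c m z" for a b
    by (simp add: prod.If_cases far_visits_def Int_def)
  have far: "norm (?w i) \<le> 4" if "?w i \<notin> near c" for i
    using fixpts_dichotomy[OF d c m funpow_fixpts[OF zf, of i]] that by (simp add: near_def)
  let ?g = "\<lambda>i. norm (?w i + D * (?w i - c))"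
  have center: "near_visits d c m c = d" "far_visits d c m c = 0" "norm (cycle_slope d c D m c) = norm c ^ d"
    if "z = c"
  proof -
    have m1: "m = 1" using z center_primpts[OF d m] that by simp
    have "card {i \<in> {..<m}. (fmap d c ^^ i) c \<in> near c} = 1" "{i \<in> {..<m}. (fmap d c ^^ i) c \<in> - near c} = {}"
      using m1 d by (auto simp: near_def funpow_center)
    then show "near_visits d c m c = d" "far_visits d c m c = 0"
      using d by (auto simp: near_visits_def far_visits_def)
    show "norm (cycle_slope d c D m c) = norm c ^ d"
      using d m1 by (simp add: cycle_slope_center norm_power)
  qed
  {
    assume A: "norm c + 4 * K \<le> A" and B: "norm D * norm c + 4 * K \<le> B"
    show "norm (cycle_slope d c D m z) \<le> A ^ near_visits d c m z * B ^ far_visits d c m z"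
    proof (cases "z = c")
      case True
      have "norm c ^ d \<le> A ^ d" using A K0 by (intro power_mono) auto
      then show ?thesis using center[OF True] unfolding True by simp
    next
      case False
      have "(\<Prod>i<m. ?g i) \<le> (\<Prod>i<m. ?a A B i)"
      proof (intro prod_mono conjI)
        fix i
        show "?g i \<le> ?a A B i"
          using norm_slope_factor_bounds(1)[OF K, of "?w i" c]
            norm_slope_factor_bounds(3)[OF K, of "?w i" c] far[of i] A B by (auto simp: near_def)
      qed simp
      then show ?thesis
        unfolding norm_cycle_slope[OF d m zf False] prod using False by (simp add: near_visits_def)
    qed
  }
  {
    assume A0: "0 \<le> A'" "0 \<le> B'" and A: "A' \<le> norm c - 4 * K" and B: "B' \<le> norm D * norm c - 4 * K"
    show "A' ^ near_visits d c m z * B' ^ far_visits d c m z \<le> norm (cycle_slope d c D m z)"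
    proof (cases "z = c")
      case True
      have "A' ^ d \<le> norm c ^ d" using A0 A K0 by (intro power_mono) auto
      then show ?thesis using center[OF True] unfolding True by simp
    next
      case False
      have "(\<Prod>i<m. ?a A' B' i) \<le> (\<Prod>i<m. ?g i)"
      proof (intro prod_mono conjI)
        fix i
        show "?a A' B' i \<le> ?g i"
          using norm_slope_factor_bounds(2)[OF K, of "?w i" c]
            norm_slope_factor_bounds(4)[OF K, of "?w i" c] far[of i] A B by (auto simp: near_def)
      qed (use A0 in auto)
      then show ?thesis
        unfolding norm_cycle_slope[OF d m zf False] prod using False by (simp add: near_visits_def)
    qed
  }
qed

lemma visits_pos:
  assumes "m > 0" shows "near_visits d c m z + far_visits d c m z > 0"
proof (rule ccontr)
  assume "\<not> near_visits d c m z + far_visits d c m z > 0"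
  then have "{i \<in> {..<m}. (fmap d c ^^ i) z \<in> near c} = {}" "{i \<in> {..<m}. (fmap d c ^^ i) z \<in> - near c} = {}"
    by (auto simp: near_visits_def far_visits_def card_eq_0_iff)
  then show False using assms by auto
qed

lemma le_visits_power:
  assumes "1 \<le> M" "M \<le> A" "M \<le> (B :: real)" "a + b > (0 :: nat)" shows "M \<le> A ^ a * B ^ b"
proof -
  have "M ^ 1 \<le> M ^ (a + b)" using assms by (intro power_increasing) auto
  also have "\<dots> = M ^ a * M ^ b" by (rule power_add)
  also have "\<dots> \<le> A ^ a * B ^ b" using assms by (intro mult_mono power_mono) auto
  finally show ?thesis by simp
qed

lemma prod_visits:
  assumes "d \<ge> 1" "m > 0" "norm c > near_radius d m"
  defines "N \<equiv> card (near c \<inter> primpts d c m)"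
  shows "(\<Prod>z\<in>primpts d c m. e * (A ^ near_visits d c m z * B ^ far_visits d c m z))
    = e ^ card (primpts d c m) * (A ^ (m * ((d - 1) * (if m = 1 then 1 else 0) + N)) * B ^ (m * (d * N)))"
  unfolding prod.distrib prod_constant power_sum[symmetric] sum_visits[OF assms(1-3)] N_def by simp

text \<open>
  The hypothesis \<open>|x| \<le> \<kappa> M\<close> makes \<open>x\<close> at most the fraction \<open>\<kappa>\<close> of the bound for the multiplier. It is used
  with \<open>M = 1\<close> for a bound up to a constant and with \<open>M = |c|\<close> for a sharp one.
\<close>

lemma multiplier_prod_upper:
  assumes d: "d \<ge> 1" and m: "m > 0" and c: "norm c > near_radius d m"
    and K: "norm (1 + D) \<le> K"
    and A: "norm c + 4 * K \<le> A" and B: "norm D * norm c + 4 * K \<le> B"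
    and M: "1 \<le> M" "M \<le> A" "M \<le> B" "norm x \<le> \<kappa> * M"
  defines "N \<equiv> card (near c \<inter> primpts d c m)"
  shows "norm (\<Prod>z\<in>primpts d c m. x - cycle_slope d c D m z)
    \<le> (1 + \<kappa>) ^ card (primpts d c m) *
        (A ^ (m * ((d - 1) * (if m = 1 then 1 else 0) + N)) * B ^ (m * (d * N)))"
proof -
  have c8: "norm c > 8" using c radius_less_near_radius[of d m] by (simp add: radius_def)
  have k0: "\<kappa> \<ge> 0" using M norm_ge_zero[of x] by (smt (verit) mult_less_0_iff)
  have "norm (x - cycle_slope d c D m z) \<le> (1 + \<kappa>) * (A ^ near_visits d c m z * B ^ far_visits d c m z)"
    if "z \<in> primpts d c m" for z
  proof -
    have "M \<le> A ^ near_visits d c m z * B ^ far_visits d c m z"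
      by (rule le_visits_power[OF M(1-3) visits_pos[OF m]])
    then have "\<kappa> * M \<le> \<kappa> * (A ^ near_visits d c m z * B ^ far_visits d c m z)"
      using k0 by (rule mult_left_mono)
    then show ?thesis
      using norm_triangle_ineq4[of x "cycle_slope d c D m z"] M(4)
        cycle_slope_bounds(1)[OF d m c8 that K A B] by (simp add: distrib_right)
  qed
  then have "(\<Prod>z\<in>primpts d c m. norm (x - cycle_slope d c D m z))
      \<le> (\<Prod>z\<in>primpts d c m. (1 + \<kappa>) * (A ^ near_visits d c m z * B ^ far_visits d c m z))"
    by (intro prod_mono) auto
  then show ?thesis unfolding prod_visits[OF d m c] prod_norm N_def .
qed

lemma multiplier_prod_lower:
  assumes d: "d \<ge> 1" and m: "m > 0" and c: "norm c > near_radius d m"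
    and K: "norm (1 + D) \<le> K"
    and A: "A \<le> norm c - 4 * K" and B: "B \<le> norm D * norm c - 4 * K"
    and M: "1 \<le> M" "M \<le> A" "M \<le> B" "norm x \<le> \<kappa> * M" and \<kappa>: "\<kappa> \<le> 1"
  defines "N \<equiv> card (near c \<inter> primpts d c m)"
  shows "(1 - \<kappa>) ^ card (primpts d c m) *
        (A ^ (m * ((d - 1) * (if m = 1 then 1 else 0) + N)) * B ^ (m * (d * N)))
    \<le> norm (\<Prod>z\<in>primpts d c m. x - cycle_slope d c D m z)"
proof -
  have c8: "norm c > 8" using c radius_less_near_radius[of d m] by (simp add: radius_def)
  have k0: "\<kappa> \<ge> 0" using M norm_ge_zero[of x] by (smt (verit) mult_less_0_iff)
  have AB: "0 \<le> A" "0 \<le> B" using M by auto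
  have "(1 - \<kappa>) * (A ^ near_visits d c m z * B ^ far_visits d c m z) \<le> norm (x - cycle_slope d c D m z)"
    if "z \<in> primpts d c m" for z
  proof -
    have "M \<le> A ^ near_visits d c m z * B ^ far_visits d c m z"
      by (rule le_visits_power[OF M(1-3) visits_pos[OF m]])
    then have "\<kappa> * M \<le> \<kappa> * (A ^ near_visits d c m z * B ^ far_visits d c m z)"
      using k0 by (rule mult_left_mono)
    then show ?thesis
      using norm_triangle_ineq2[of "cycle_slope d c D m z" x] M(4)
        cycle_slope_bounds(2)[OF d m c8 that K AB A B] by (simp add: left_diff_distrib norm_minus_commute)
  qed
  then have "(\<Prod>z\<in>primpts d c m. (1 - \<kappa>) * (A ^ near_visits d c m z * B ^ far_visits d c m z))
      \<le> (\<Prod>z\<in>primpts d c m. norm (x - cycle_slope d c D m z))"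
    using \<kappa> AB by (intro prod_mono) auto
  then show ?thesis unfolding prod_visits[OF d m c] prod_norm N_def .
qed

section \<open>Products over orbits\<close>

text \<open>
  Removing one orbit splits off the factor \<open>(z - h x)\<^sup>m\<close>.
\<close>

lemma prod_over_orbits_is_power:
  fixes h :: "'a \<Rightarrow> 'b :: idom"
  assumes "finite X" "m > 0" "\<And>x. x \<in> X \<Longrightarrow> f x \<in> X" "\<And>x. x \<in> X \<Longrightarrow> (f ^^ m) x = x"
    "\<And>x k. x \<in> X \<Longrightarrow> 0 < k \<Longrightarrow> k < m \<Longrightarrow> (f ^^ k) x \<noteq> x" "\<And>x. x \<in> X \<Longrightarrow> h (f x) = h x"
  shows "\<exists>q. lead_coeff q = 1 \<and> (\<Prod>x\<in>X. [:- h x, 1:]) = q ^ m"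
  using assms(1,3-)
proof (induction X rule: finite_psubset_induct)
  case (psubset X)
  note inv = psubset.prems(1) and per = psubset.prems(2) and min = psubset.prems(3) and h = psubset.prems(4)
  show ?case
  proof (cases "X = {}")
    case False
    then obtain x where x: "x \<in> X" by blast
    define O' where "O' = (\<lambda>i. (f ^^ i) x) ` {..<m}"
    have orb: "(f ^^ i) x \<in> X" for i using x inv by (induction i) auto
    have OX: "O' \<subseteq> X" "O' \<noteq> {}" using orb \<open>m > 0\<close> by (auto simp: O'_def)
    have memO: "(f ^^ i) x \<in> O'" for i
      using funpow_mod_period[OF per[OF x], of i] \<open>m > 0\<close> unfolding O'_def by (metis imageI lessThan_iff mod_less_divisor)
    have ne: "(f ^^ i) x \<noteq> (f ^^ j) x" if "i < j" "j < m" for i j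
    proof
      assume "(f ^^ i) x = (f ^^ j) x"
      then have "(f ^^ (m - j)) ((f ^^ i) x) = (f ^^ (m - j)) ((f ^^ j) x)" by simp
      then have "(f ^^ (m - j + i)) x = (f ^^ (m - j + j)) x" by (simp only: funpow_add o_apply)
      then have eq: "(f ^^ (m - j + i)) x = x" using that per[OF x] by simp
      have "0 < m - j + i" "m - j + i < m" using that by auto
      from min[OF x this] eq show False by (rule notE)
    qed
    have "inj_on (\<lambda>i. (f ^^ i) x) {..<m}"
    proof (rule inj_onI)
      fix i j assume "i \<in> {..<m}" "j \<in> {..<m}" "(f ^^ i) x = (f ^^ j) x"
      then show "i = j" using ne[of i j] ne[of j i] by (cases i j rule: linorder_cases) simp_all
    qed
    then have cardO: "card O' = m" by (simp add: O'_def card_image)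
    have hO: "h y = h x" if y: "y \<in> O'" for y
    proof -
      have "h ((f ^^ i) x) = h x" for i using h orb by (induction i) auto
      then show ?thesis using y by (auto simp: O'_def)
    qed
    have inv': "f y \<in> X - O'" if y: "y \<in> X - O'" for y
    proof
      show "f y \<in> X" using inv y by simp
      show "f y \<notin> O'"
      proof
        assume "f y \<in> O'"
        then obtain i where "f y = (f ^^ i) x" by (auto simp: O'_def)
        moreover have "y = (f ^^ (m - 1)) (f y)"
          using per[of y] y \<open>m > 0\<close> by (cases m) (auto simp: funpow_swap1)
        ultimately have "y = (f ^^ (m - 1 + i)) x" by (simp add: funpow_add)
        then show False using memO y by auto
      qed
    qed
    have sub: "X - O' \<subset> X" using OX by blast
    have "\<exists>q. lead_coeff q = 1 \<and> (\<Prod>x\<in>X - O'. [:- h x, 1:]) = q ^ m"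
      by (rule psubset.IH[OF sub inv']) (simp_all add: per min h)
    then obtain q where q: "lead_coeff q = 1" "(\<Prod>x\<in>X - O'. [:- h x, 1:]) = q ^ m" by blast
    have "(\<Prod>x\<in>X. [:- h x, 1:]) = (\<Prod>x\<in>X - O'. [:- h x, 1:]) * (\<Prod>x\<in>O'. [:- h x, 1:])"
      by (rule prod.subset_diff) (use OX psubset in auto)
    also have "(\<Prod>x\<in>O'. [:- h x, 1:]) = [:- h x, 1:] ^ m"
      using hO cardO by simp
    finally have "(\<Prod>x\<in>X. [:- h x, 1:]) = (q * [:- h x, 1:]) ^ m" by (simp only: q(2) power_mult_distrib)
    moreover have "lead_coeff (q * [:- h x, 1:]) = 1" unfolding lead_coeff_mult q(1) by simp
    ultimately show ?thesis by blast
  qed (auto intro!: exI[of _ 1])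
qed

section \<open>Evaluation of the multiplier resultant\<close>

text \<open>
  A ring homomorphism commutes with the resultant as soon as it preserves the two degrees.
\<close>

lemma hom_resultant_root_poly:
  fixes h :: "'a :: comm_ring_1 \<Rightarrow> complex"
  assumes "comm_ring_hom h" and p: "lead_coeff p = 1" "map_poly h p = root_poly A" and A: "finite A"
    and q: "degree (map_poly h q) = degree q"
  shows "h (resultant p q) = (\<Prod>a\<in>A. poly (map_poly h q) a)"
proof -
  interpret comm_ring_hom h by fact
  have "coeff (map_poly h p) (degree p) = 1" using p(1) by simp
  then have "degree p \<le> degree (map_poly h p)" by (intro le_degree) simp
  then have "degree (map_poly h p) = degree p" using degree_map_poly_le[of h p] by simp
  then have "h (resultant p q) = resultant (map_poly h p) (map_poly h q)"
    using q by (rule resultant_map_poly[symmetric])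
  also have "\<dots> = (\<Prod>a\<in>A. poly (map_poly h q) a)"
    unfolding p(2) root_poly_def by (rule resultant_prod_roots_set[OF A])
  finally show ?thesis .
qed

lemma map_poly_eval2_const: "map_poly (\<lambda>A. eval2 A c x) (map_poly (\<lambda>a. [:a:]) p) = map_poly (spec c) p"
  by (subst map_poly_map_poly) (auto simp: o_def intro!: map_poly_cong)

text \<open>
  The derivative of the iterate has the integer leading coefficient \<open>(d + 1)\<^sup>m\<close> and positive degree, so the
  degree of the second argument of the resultant does not drop under specialisation.
\<close>

lemma eval2_multiplier_resultant:
  assumes d: "d \<ge> 1" and m: "m > 0" and c: "norm c > radius d"
  shows "eval2 (multiplier_resultant d m) c x
    = (\<Prod>\<alpha>\<in>primpts d c m. x - cycle_slope d c (of_nat d) m \<alpha>)"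
proof -
  let ?h = "\<lambda>A. eval2 A c x" and ?e = "\<lambda>p. map_poly (\<lambda>a. [:a:]) p :: int poly poly poly"
  let ?g = "pderiv (ftilde_iter d m)"
  let ?q = "[:[:0, 1:]:] - ?e ?g"
  have deg_e: "degree (?e p) = degree p" for p by (rule degree_map_poly) simp
  have coeff_e: "coeff (?e p) n = [:coeff p n:]" for p n by (simp add: coeff_map_poly)
  have dg: "degree ?g = (d + 1) ^ m - 1" by (simp add: degree_pderiv iter_monic(1)[OF d])
  have "(d + 1) ^ 1 \<le> (d + 1) ^ m" using m by (intro power_increasing) auto
  then have dg0: "degree ?g > 0" and ge: "(d + 1) ^ m = Suc (degree ?g)" using d dg by auto
  have "lead_coeff ?g = of_nat (Suc (degree ?g)) * coeff (ftilde_iter d m) (Suc (degree ?g))"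
    by (simp add: coeff_pderiv)
  also have "coeff (ftilde_iter d m) (Suc (degree ?g)) = 1"
    using iter_monic[OF d, of m] unfolding ge by simp
  finally have lead: "lead_coeff ?g = of_nat (Suc (degree ?g))" by simp
  have lq: "coeff ?q (degree ?g) = - [:of_nat (Suc (degree ?g)):]"
    using dg0 lead by (simp add: coeff_e coeff_pCons split: nat.split)
  have "degree ?q \<le> degree ?g" by (intro degree_diff_le) (simp_all add: deg_e)
  moreover have "coeff (map_poly ?h ?q) (degree ?g) = - of_nat (Suc (degree ?g))"
  proof -
    have "coeff (map_poly ?h ?q) (degree ?g) = ?h (coeff ?q (degree ?g))" by (rule coeff_map_poly) simp
    then show ?thesis unfolding lq by (simp add: hom_distribs del: of_nat_Suc)
  qed
  then have "degree ?g \<le> degree (map_poly ?h ?q)" by (intro le_degree) (simp del: of_nat_Suc)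
  ultimately have dq: "degree (map_poly ?h ?q) = degree ?q"
    using degree_map_poly_le[of ?h ?q] by simp
  have "lead_coeff (?e (dynatomic d m)) = 1"
    using dynatomic_spec(1)[OF d m] by (simp add: deg_e coeff_e one_pCons)
  moreover have "map_poly ?h (?e (dynatomic d m)) = root_poly (primpts d c m)"
    unfolding map_poly_eval2_const by (rule dynatomic_spec(2)[OF d m c])
  ultimately have "?h (multiplier_resultant d m) = (\<Prod>\<alpha>\<in>primpts d c m. poly (map_poly ?h ?q) \<alpha>)"
    unfolding multiplier_resultant_def
    by (intro hom_resultant_root_poly eval2.comm_ring_hom_axioms finite_primpts[OF d c m] dq)
  moreover have "poly (map_poly ?h ?q) \<alpha> = x - cycle_slope d c (of_nat d) m \<alpha>" for \<alpha>
  proof -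
    interpret eh: map_poly_comm_ring_hom ?h ..
    have "map_poly ?h ?q = [:x:] - map_poly (spec c) ?g"
      unfolding eh.hom_minus map_poly_eval2_const by (simp add: map_poly_pCons)
    then show ?thesis using eval2_pderiv_iter[OF d, of m c \<alpha>] by (simp add: eval2_def)
  qed
  ultimately show ?thesis by (simp only:)
qed

section \<open>The resultant with a generic slope parameter\<close>

definition eval3 :: "int poly poly poly \<Rightarrow> complex \<Rightarrow> complex \<Rightarrow> complex \<Rightarrow> complex" where
  "eval3 P c x D = poly (map_poly (\<lambda>A. eval2 A c x) P) D"

interpretation eval2_poly: map_poly_comm_ring_hom "\<lambda>A. eval2 A c x" for c x ..

interpretation eval3: comm_ring_hom "\<lambda>P. eval3 P c x D" for c x D
  by unfold_locales (simp_all add: eval3_def hom_distribs)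

interpretation eval3_poly: map_poly_comm_ring_hom "\<lambda>P. eval3 P c x D" for c x D ..

lemma eval3_pCons [simp]: "eval3 (pCons A P) c x D = eval2 A c x + D * eval3 P c x D"
  by (cases "A = 0 \<and> P = 0") (auto simp: eval3_def map_poly_pCons)

text \<open>
  The product of the slopes along the orbit of \<open>z\<close>, in \<open>\<int>[c][x][D][z]\<close> with \<open>z\<close> outermost. The constant
  \<open>[:[:0, 1:]:]\<close> is \<open>D\<close>, and \<open>[:[:[:[:0, 1:]:]:]:]\<close> is \<open>c\<close>.
\<close>

definition generic_slope :: "nat \<Rightarrow> nat \<Rightarrow> int poly poly poly poly" where
  "generic_slope d m = (\<Prod>i<m. let w = map_poly (\<lambda>a. [:[:a:]:]) (ftilde_iter d i) in
     w ^ (d - 1) * (w + [:[:0, 1:]:] * (w - [:[:[:[:0, 1:]:]:]:])))"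

text \<open>
  Adding a multiple of \<open>\<Phi>\<close> to \<open>q\<close> does not change the values of \<open>q\<close> at the roots of \<open>\<Phi>\<close>. The summand chosen
  here makes the second argument monic, so that its degree survives every specialisation, in particular
  \<open>D = -1\<close>, where the degree of the slope drops.
\<close>

definition generic_resultant :: "nat \<Rightarrow> nat \<Rightarrow> int poly poly poly" where
  "generic_resultant d m =
    (let \<Phi> = map_poly (\<lambda>a. [:[:a:]:]) (dynatomic d m); q = [:[:[:0, 1:]:]:] - generic_slope d m
     in resultant \<Phi> (q + monom 1 (Suc (degree q)) * \<Phi>))"

lemma map_poly_eval3_const:
  "map_poly (\<lambda>P. eval3 P c x D) (map_poly (\<lambda>a. [:[:a:]:]) p) = map_poly (spec c) p"
  by (subst map_poly_map_poly) (auto simp: o_def intro!: map_poly_cong)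

lemma eval3_generic_resultant:
  assumes d: "d \<ge> 1" and m: "m > 0" and c: "norm c > radius d"
  shows "eval3 (generic_resultant d m) c x D = (\<Prod>\<alpha>\<in>primpts d c m. x - cycle_slope d c D m \<alpha>)"
proof -
  let ?h = "\<lambda>P. eval3 P c x D" and ?e = "\<lambda>p. map_poly (\<lambda>a. [:[:a:]:]) p :: int poly poly poly poly"
  define \<Phi> where "\<Phi> = ?e (dynatomic d m)"
  define q where "q = [:[:[:0, 1:]:]:] - generic_slope d m"
  define s where "s = q + monom 1 (Suc (degree q)) * \<Phi>"
  have deg_e: "degree (?e p) = degree p" for p by (rule degree_map_poly) simp
  have coeff_e: "coeff (?e p) n = [:[:coeff p n:]:]" for p n by (simp add: coeff_map_poly)
  have lead\<Phi>: "lead_coeff \<Phi> = 1"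
    using dynatomic_spec(1)[OF d m] by (simp add: \<Phi>_def deg_e coeff_e one_pCons)
  have \<Phi>: "map_poly ?h \<Phi> = root_poly (primpts d c m)"
    unfolding \<Phi>_def map_poly_eval3_const by (rule dynatomic_spec(2)[OF d m c])
  let ?t = "monom 1 (Suc (degree q)) * \<Phi>"
  have "\<Phi> \<noteq> 0" using lead\<Phi> by auto
  then have dt: "degree ?t = Suc (degree q) + degree \<Phi>" by (simp add: degree_mult_eq degree_monom_eq)
  then have "degree q < degree ?t" by simp
  then have "lead_coeff s = lead_coeff ?t" unfolding s_def by (rule lead_coeff_add_le)
  then have lead_s: "lead_coeff s = 1" unfolding lead_coeff_mult using lead\<Phi> by (simp add: degree_monom_eq)
  then have "coeff (map_poly ?h s) (degree s) = 1" by simp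
  then have "degree s \<le> degree (map_poly ?h s)" by (intro le_degree) simp
  then have ds: "degree (map_poly ?h s) = degree s" using degree_map_poly_le[of ?h s] by simp
  have "?h (resultant \<Phi> s) = (\<Prod>\<alpha>\<in>primpts d c m. poly (map_poly ?h s) \<alpha>)"
    by (rule hom_resultant_root_poly[OF eval3.comm_ring_hom_axioms lead\<Phi> \<Phi> finite_primpts[OF d c m] ds])
  also have "\<dots> = (\<Prod>\<alpha>\<in>primpts d c m. x - cycle_slope d c D m \<alpha>)"
  proof (intro prod.cong refl)
    fix \<alpha> assume "\<alpha> \<in> primpts d c m"
    then have "poly (map_poly ?h \<Phi>) \<alpha> = 0"
      unfolding \<Phi> root_poly_def poly_prod using finite_primpts[OF d c m] by (auto intro!: prod_zero)
    then have "poly (map_poly ?h s) \<alpha> = poly (map_poly ?h q) \<alpha>"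
      by (simp add: s_def eval3_poly.hom_add eval3_poly.hom_mult)
    also have "\<dots> = x - poly (map_poly ?h (generic_slope d m)) \<alpha>"
      unfolding q_def eval3_poly.hom_minus by (simp add: map_poly_pCons)
    also have "poly (map_poly ?h (generic_slope d m)) \<alpha> = cycle_slope d c D m \<alpha>"
    proof -
      have w: "poly (map_poly ?h (?e (ftilde_iter d i))) \<alpha> = (fmap d c ^^ i) \<alpha>" for i
        unfolding map_poly_eval3_const eval2_def[symmetric] by (rule eval2_iter)
      have const: "map_poly ?h [:a:] = [:?h a:]" for a
        by (cases "a = 0") (simp_all add: map_poly_pCons)
      show ?thesis
        unfolding generic_slope_def Let_def cycle_slope_def slope_def
        by (simp only: eval3_poly.hom_prod eval3_poly.hom_mult eval3_poly.hom_add eval3_poly.hom_minus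
            eval3_poly.hom_power const poly_prod poly_mult poly_add poly_diff poly_power w) simp
    qed
    finally show "poly (map_poly ?h s) \<alpha> = x - cycle_slope d c D m \<alpha>" .
  qed
  finally show ?thesis unfolding generic_resultant_def Let_def \<Phi>_def s_def q_def .
qed

section \<open>Degrees from growth\<close>

lemma degree_le_if_growth:
  fixes p :: "complex poly"
  assumes "\<And>z. norm z > R \<Longrightarrow> norm (poly p z) \<le> C * norm z ^ k" shows "degree p \<le> k"
  using assms
proof (induction k arbitrary: p R C)
  case 0
  obtain a p' where p: "p = pCons a p'" by (cases p)
  have "p' = 0"
  proof (rule ccontr)
    assume "p' \<noteq> 0"
    then obtain r where r: "\<And>z. r \<le> norm z \<Longrightarrow> C + 1 \<le> norm (poly p z)"
      using poly_infinity[of p' "C + 1" a] p by blast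
    obtain z :: complex where "norm z > max r R"
      using infinite_norm_gt[of "max r R", THEN not_finite_existsD] by auto
    then show False using r[of z] 0[of z] by simp
  qed
  then show ?case using p by simp
next
  case (Suc k)
  obtain a p' where p: "p = pCons a p'" by (cases p)
  have "degree p' \<le> k"
  proof (rule Suc.IH[of "max R 1" p' "\<bar>C\<bar> + norm a"])
    fix z :: complex assume z: "norm z > max R 1"
    have z1: "1 \<le> norm z ^ k" using z by (intro one_le_power) simp
    have "norm z * norm (poly p' z) = norm (poly p z - a)" by (simp add: p norm_mult)
    also have "\<dots> \<le> norm (poly p z) + norm a" by (rule norm_triangle_ineq4)
    also have "norm (poly p z) \<le> C * norm z ^ Suc k" using Suc.prems z by simp
    also have "\<dots> \<le> \<bar>C\<bar> * norm z ^ Suc k" by (intro mult_right_mono) auto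
    also have "norm a \<le> norm a * norm z ^ Suc k"
      using mult_left_mono[of 1 "norm z ^ Suc k" "norm a"] one_le_power[of "norm z" "Suc k"] z by simp
    finally have "norm z * norm (poly p' z) \<le> norm z * ((\<bar>C\<bar> + norm a) * norm z ^ k)"
      by (simp add: algebra_simps)
    then show "norm (poly p' z) \<le> (\<bar>C\<bar> + norm a) * norm z ^ k"
      using z by (subst (asm) mult_le_cancel_left_pos) auto
  qed
  then show ?case using p degree_pCons_le[of a p'] by simp
qed

lemma poly_eq_sum_le:
  fixes p :: "'a :: comm_semiring_1 poly"
  assumes "degree p \<le> n" shows "poly p x = (\<Sum>i\<le>n. coeff p i * x ^ i)"
  using arg_cong[OF poly_as_sum_of_monoms'[OF assms], of "\<lambda>p. poly p x"]
  by (simp add: poly_sum poly_monom)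

lemma eval2_eq_sum_le:
  assumes "degree A \<le> n" shows "eval2 A u v = (\<Sum>i\<le>n. spec u (coeff A i) * v ^ i)"
  unfolding eval2_def using degree_map_poly_le[of "spec u" A] assms by (subst poly_eq_sum_le) auto

lemma eval3_eq_sum: "eval3 P c x D = (\<Sum>i\<le>degree P. eval2 (coeff P i) c x * D ^ i)"
  unfolding eval3_def
  using degree_map_poly_le[of "\<lambda>A. eval2 A c x" P] by (subst poly_eq_sum_le) (auto simp: coeff_map_poly)

text \<open>
  Multiplied by a power of \<open>c\<close>, the function \<open>P(c, x, s / c)\<close> is a polynomial in \<open>c\<close> whose coefficients are
  polynomials in \<open>s\<close>. Coefficients beyond the growth rate vanish for all \<open>s\<close>, and for a given power of \<open>c\<close> the
  different powers of \<open>s\<close> separate the powers of \<open>D\<close>.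
\<close>

lemma coeff_zero_if_weighted_growth:
  assumes growth: "\<And>s x. \<exists>C R. \<forall>c. norm c > R \<longrightarrow> norm (eval3 P c x (s / c)) \<le> C * norm c ^ K"
    and P': "\<And>i x c. eval2 (P' i) x c = eval2 (coeff P i) c x"
    and i: "i \<le> degree P" and j: "j > K + i"
  shows "coeff (P' i) j = 0"
proof (rule spec_eq_0[of 0])
  fix x :: complex
  let ?M = "degree P" and ?p = "\<lambda>i. map_poly (spec x) (P' i)"
  define q where "q s = (\<Sum>i\<le>?M. Polynomial.smult (s ^ i) (monom 1 (?M - i) * ?p i))" for s
  have "degree (q s) \<le> ?M + K" for s
  proof -
    obtain C R where CR: "\<And>c. norm c > R \<Longrightarrow> norm (eval3 P c x (s / c)) \<le> C * norm c ^ K"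
      using growth[of x s] by blast
    show ?thesis
    proof (rule degree_le_if_growth[of "max R 0"])
      fix c :: complex assume c: "norm c > max R 0"
      then have c0: "c \<noteq> 0" by auto
      have "poly (q s) c = (\<Sum>i\<le>?M. c ^ ?M * (eval2 (coeff P i) c x * (s / c) ^ i))"
        unfolding q_def poly_sum
      proof (intro sum.cong refl)
        fix i assume "i \<in> {..?M}"
        then have "c ^ ?M = c ^ (?M - i) * c ^ i" by (simp add: power_add[symmetric])
        then show "poly (Polynomial.smult (s ^ i) (monom 1 (?M - i) * ?p i)) c
            = c ^ ?M * (eval2 (coeff P i) c x * (s / c) ^ i)"
          using c0 P'[of i x c] by (simp add: poly_monom power_divide eval2_def)
      qed
      also have "\<dots> = c ^ ?M * eval3 P c x (s / c)" unfolding eval3_eq_sum by (simp add: sum_distrib_left)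
      finally have "norm (poly (q s) c) = norm c ^ ?M * norm (eval3 P c x (s / c))"
        by (simp add: norm_mult norm_power)
      also have "\<dots> \<le> norm c ^ ?M * (C * norm c ^ K)" using CR c by (intro mult_left_mono) auto
      finally show "norm (poly (q s) c) \<le> C * norm c ^ (?M + K)" by (simp add: power_add mult_ac)
    qed
  qed
  moreover have "?M + K < ?M - i + j" using i j by simp
  ultimately have "degree (q s) < ?M - i + j" for s by (rule le_less_trans)
  then have "coeff (q s) (?M - i + j) = 0" for s by (rule coeff_eq_0)
  moreover have "coeff (q s) (?M - i + j)
      = poly (\<Sum>i'\<le>?M. monom (coeff (monom 1 (?M - i') * ?p i') (?M - i + j)) i') s" for s
    by (simp add: q_def coeff_sum poly_sum poly_monom mult.commute)
  ultimately have "(\<Sum>i'\<le>?M. monom (coeff (monom 1 (?M - i') * ?p i') (?M - i + j)) i') = 0"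
    by (intro poly_eq_0_if_large_roots[of 0]) simp
  then have "coeff (\<Sum>i'\<le>?M. monom (coeff (monom 1 (?M - i') * ?p i') (?M - i + j)) i') i = 0" by simp
  then have "coeff (monom 1 (?M - i) * ?p i) (?M - i + j) = 0" using i by (simp add: coeff_sum)
  then show "spec x (coeff (P' i) j) = 0" by (simp add: coeff_monom_mult)
qed

text \<open>
  With \<open>D = s / c\<close> the factors near \<open>c\<close> are \<open>O(c)\<close> and the factors near \<open>0\<close> are \<open>O(1)\<close>.
\<close>

lemma generic_resultant_growth:
  assumes d: "d \<ge> 1" and m: "m > 0"
    and N: "\<And>c. norm c > near_radius d m \<Longrightarrow> card (near c \<inter> primpts d c m) = N"
  shows "\<exists>C R. \<forall>c. norm c > R \<longrightarrow> norm (eval3 (generic_resultant d m) c x (s / c))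
    \<le> C * norm c ^ (m * ((d - 1) * (if m = 1 then 1 else 0) + N))"
proof -
  define K where "K = 1 + norm s"
  define N' where "N' = m * ((d - 1) * (if m = 1 then 1 else 0) + N)"
  define F where "F = m * (d * N)"
  define C where "C = (1 + norm x) ^ degree (dynatomic d m) * ((1 + 4 * K) ^ N' * (norm s + 4 * K) ^ F)"
  have K1: "K \<ge> 1" by (simp add: K_def)
  have "norm (eval3 (generic_resultant d m) c x (s / c)) \<le> C * norm c ^ N'"
    if c: "norm c > near_radius d m" for c
  proof -
    have c': "norm c > radius d" using c radius_less_near_radius[of d m] by simp
    have c1: "norm c > 1" using c' by (simp add: radius_def)
    then have c0: "c \<noteq> 0" by auto
    have "norm (s / c) \<le> norm s" using c1 by (simp add: norm_divide divide_le_eq mult_le_cancel_left1)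
    then have K: "norm (1 + s / c) \<le> K" using norm_triangle_ineq[of 1 "s / c"] by (simp add: K_def)
    have A: "norm c + 4 * K \<le> (1 + 4 * K) * norm c"
      using K1 c1 mult_left_mono[of 1 "norm c" "4 * K"] by (simp add: distrib_right)
    have B: "norm (s / c) * norm c + 4 * K \<le> norm s + 4 * K" using c0 by (simp add: norm_divide)
    have M: "1 \<le> (1 + 4 * K) * norm c" "1 \<le> norm s + 4 * K"
      using A K1 c1 norm_ge_zero[of s] by linarith+
    have "norm (eval3 (generic_resultant d m) c x (s / c))
      \<le> (1 + norm x) ^ degree (dynatomic d m) * (((1 + 4 * K) * norm c) ^ N' * (norm s + 4 * K) ^ F)"
      using multiplier_prod_upper[OF d m c K A B order_refl M, of x "norm x"]
      unfolding eval3_generic_resultant[OF d m c'] N[OF c] card_primpts[OF d m c'] N'_def F_def by simp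
    also have "\<dots> = C * norm c ^ N'" by (simp add: C_def power_mult_distrib mult_ac)
    finally show ?thesis .
  qed
  then show ?thesis unfolding N'_def by blast
qed

section \<open>The multiplier polynomial\<close>

lemma multiplier_resultant_spec:
  assumes d: "d \<ge> 1" and m: "m > 0" and c: "norm c > radius d"
  shows "map_poly (spec c) (multiplier_resultant d m)
    = (\<Prod>\<alpha>\<in>primpts d c m. [:- cycle_slope d c (of_nat d) m \<alpha>, 1:])"
proof -
  have "poly (map_poly (spec c) (multiplier_resultant d m)) x
    = poly (\<Prod>\<alpha>\<in>primpts d c m. [:- cycle_slope d c (of_nat d) m \<alpha>, 1:]) x" for x
    using eval2_multiplier_resultant[OF assms, of x] by (simp add: eval2_def poly_prod)
  then show ?thesis by (intro poly_eq_poly_eq_iff[THEN iffD1] ext)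
qed

lemma multiplier_resultant_monic:
  assumes d: "d \<ge> 1" and m: "m > 0" shows "lead_coeff (multiplier_resultant d m) = 1"
proof -
  let ?P = "multiplier_resultant d m" and ?\<nu> = "degree (dynatomic d m)"
  have deg: "degree (map_poly (spec c) ?P) = ?\<nu>" and lead: "lead_coeff (map_poly (spec c) ?P) = 1"
    if c: "norm c > radius d" for c
    unfolding multiplier_resultant_spec[OF d m c] card_primpts[OF d m c, symmetric]
    by (subst degree_prod_eq_sum_degree) (auto simp: lead_coeff_prod)
  have "coeff ?P ?\<nu> - 1 = 0"
  proof (rule spec_eq_0[of "radius d"])
    fix c :: complex assume c: "norm c > radius d"
    show "spec c (coeff ?P ?\<nu> - 1) = 0" using lead[OF c] unfolding deg[OF c] by (simp add: hom_distribs)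
  qed
  moreover have "coeff ?P j = 0" if j: "j > ?\<nu>" for j
  proof (rule spec_eq_0[of "radius d"])
    fix c :: complex assume c: "norm c > radius d"
    have "coeff (map_poly (spec c) ?P) j = 0" using j deg[OF c] by (intro coeff_eq_0) simp
    then show "spec c (coeff ?P j) = 0" by simp
  qed
  then have "degree ?P \<le> ?\<nu>" by (intro degree_le) auto
  ultimately show ?thesis by (metis eq_iff_diff_eq_0 le_antisym le_degree zero_neq_one)
qed

text \<open>
  In every specialisation the resultant is an \<open>m\<close>-th power, because the points of exact period \<open>m\<close> form
  cycles of length \<open>m\<close> on which the multiplier is constant.
\<close>

lemma multiplier_poly_spec:
  assumes d: "d \<ge> 1" and m: "m > 0"
  shows "lead_coeff (multiplier_poly d m) = 1" "multiplier_poly d m ^ m = multiplier_resultant d m"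
proof -
  have "\<exists>\<delta>. lead_coeff \<delta> = 1 \<and> \<delta> ^ m = multiplier_resultant d m"
  proof (rule monic_root_exists[OF multiplier_resultant_monic[OF d m] m, of "radius d"])
    fix c :: complex assume c: "norm c > radius d"
    show "\<exists>q. lead_coeff q = 1 \<and> map_poly (spec c) (multiplier_resultant d m) = q ^ m"
      unfolding multiplier_resultant_spec[OF d m c]
    proof (rule prod_over_orbits_is_power[where f = "fmap d c", OF finite_primpts[OF d c m] m])
      fix \<alpha> assume \<alpha>: "\<alpha> \<in> primpts d c m"
      show "fmap d c \<alpha> \<in> primpts d c m" using funpow_primpts[OF \<alpha> m, of 1] by simp
      show "(fmap d c ^^ m) \<alpha> = \<alpha>" using \<alpha> by (simp add: primpts_def fixpts_def)
      show "(fmap d c ^^ k) \<alpha> \<noteq> \<alpha>" if "0 < k" "k < m" for k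
        using \<alpha> that by (auto simp: primpts_def fixpts_def)
      show "cycle_slope d c (of_nat d) m (fmap d c \<alpha>) = cycle_slope d c (of_nat d) m \<alpha>"
        using \<alpha> d by (intro cycle_slope_shift) (auto simp: primpts_def)
    qed
  qed
  then obtain \<delta> where \<delta>: "lead_coeff \<delta> = 1 \<and> \<delta> ^ m = multiplier_resultant d m" by blast
  have "multiplier_poly d m = \<delta>" unfolding multiplier_poly_def
  proof (rule the_equality)
    fix \<delta>' assume \<delta>': "lead_coeff \<delta>' = 1 \<and> \<delta>' ^ m = multiplier_resultant d m"
    show "\<delta>' = \<delta>"
      by (rule monic_root_unique[OF trans[OF conjunct2[OF \<delta>'] conjunct2[OF \<delta>, symmetric]]
            conjunct1[OF \<delta>'] conjunct1[OF \<delta>] m])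
  qed (rule \<delta>)
  then show "lead_coeff (multiplier_poly d m) = 1" "multiplier_poly d m ^ m = multiplier_resultant d m"
    using \<delta> by auto
qed

text \<open>
  Rotation permutes the points of exact period \<open>m\<close> and preserves multipliers, so it fixes the resultant, and
  with it the unique monic \<open>m\<close>-th root.
\<close>

lemma multiplier_poly_rotate:
  assumes d: "d \<ge> 1" and m: "m > 0" and \<zeta>: "\<zeta> ^ d = 1" and c: "norm c > radius d"
  shows "eval2 (multiplier_poly d m) (\<zeta> * c) x = eval2 (multiplier_poly d m) c x"
proof -
  have "norm \<zeta> ^ d = 1" using \<zeta> by (metis norm_one norm_power)
  then have "norm \<zeta> = 1" using d power_eq_imp_eq_base[of "norm \<zeta>" d 1] by simp
  then have c': "norm (\<zeta> * c) > radius d" using c by (simp add: norm_mult)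
  have "inj_on (\<lambda>z. \<zeta> * z) (primpts d c m)" using \<open>norm \<zeta> = 1\<close> by (auto intro!: inj_onI)
  then have "map_poly (spec (\<zeta> * c)) (multiplier_resultant d m) = map_poly (spec c) (multiplier_resultant d m)"
    unfolding multiplier_resultant_spec[OF d m c'] multiplier_resultant_spec[OF d m c]
      primpts_rotate[OF \<zeta> d] by (simp add: prod.reindex cycle_slope_rotate[OF \<zeta> d])
  then have "map_poly (spec (\<zeta> * c)) (multiplier_poly d m) ^ m = map_poly (spec c) (multiplier_poly d m) ^ m"
    unfolding multiplier_poly_spec(2)[OF d m, symmetric] by (simp only: spec_poly.hom_power)
  then have "map_poly (spec (\<zeta> * c)) (multiplier_poly d m) = map_poly (spec c) (multiplier_poly d m)"
    by (rule monic_root_unique[OF _ _ _ m]) (rule degree_map_poly_spec_monic(2)[OF multiplier_poly_spec(1)[OF d m]])+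
  then show ?thesis by (simp add: eval2_def)
qed

section \<open>Rescaling the parameter\<close>

lemma eval2_monom: "eval2 (monom a j) u v = spec u a * v ^ j"
proof -
  have "map_poly (spec u) (monom a j) = monom (spec u a) j" by (simp add: map_poly_monom)
  then show ?thesis by (simp add: eval2_def poly_monom)
qed

text \<open>
  The substitution \<open>c = s / d\<close>, cleared of denominators by the factor \<open>d\<^sup>e\<close>.
\<close>

definition rescale :: "nat \<Rightarrow> nat \<Rightarrow> int poly poly \<Rightarrow> int poly poly" where
  "rescale d e B = (\<Sum>j\<le>e. monom (of_nat (d ^ (e - j)) * coeff B j) j)"

lemma eval2_rescale:
  assumes "\<And>j. j > e \<Longrightarrow> coeff B j = 0"
  shows "eval2 (rescale d e B) x (of_nat d * c) = of_nat d ^ e * eval2 B x c"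
proof -
  have "degree B \<le> e" using assms by (intro degree_le) auto
  have "eval2 (rescale d e B) x (of_nat d * c)
      = (\<Sum>j\<le>e. of_nat d ^ (e - j) * spec x (coeff B j) * (of_nat d * c) ^ j)"
    unfolding rescale_def by (simp add: eval2.hom_sum eval2_monom spec.hom_mult spec.hom_power)
  also have "\<dots> = (\<Sum>j\<le>e. of_nat d ^ e * (spec x (coeff B j) * c ^ j))"
  proof (intro sum.cong refl)
    fix j assume "j \<in> {..e}"
    then have "(of_nat d :: complex) ^ e = of_nat d ^ (e - j) * of_nat d ^ j"
      by (simp add: power_add[symmetric])
    then show "of_nat d ^ (e - j) * spec x (coeff B j) * (of_nat d * c) ^ j
      = of_nat d ^ e * (spec x (coeff B j) * c ^ j)" by (simp add: power_mult_distrib)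
  qed
  finally show ?thesis
    unfolding eval2_eq_sum_le[OF \<open>degree B \<le> e\<close>] by (simp add: sum_distrib_left)
qed

lemma exists_rescaled_resultant:
  assumes d: "d \<ge> 1" and m: "m > 0"
    and N: "\<And>c. norm c > near_radius d m \<Longrightarrow> card (near c \<inter> primpts d c m) = N"
  defines "N' \<equiv> (d - 1) * (if m = 1 then 1 else 0) + N"
  shows "\<exists>V. \<forall>x c. norm c > radius d \<longrightarrow>
    eval2 V x (of_nat d * c) = of_nat d ^ (m * N') * eval2 (multiplier_resultant d m) c x"
proof -
  let ?P = "generic_resultant d m"
  have "\<forall>i. \<exists>B. \<forall>u v. eval2 B v u = eval2 (coeff ?P i) u v" using exists_swap by blast
  then obtain P' where P': "\<And>i u v. eval2 (P' i) v u = eval2 (coeff ?P i) u v" by metis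
  have zero: "coeff (P' i) j = 0" if "i \<le> degree ?P" "j > m * N' + i" for i j
  proof (rule coeff_zero_if_weighted_growth[OF _ P' that])
    show "\<exists>C R. \<forall>c. norm c > R \<longrightarrow> norm (eval3 ?P c x (s / c)) \<le> C * norm c ^ (m * N')" for s x
      unfolding N'_def by (rule generic_resultant_growth[OF d m N])
  qed
  \<comment> \<open>the power \<open>D\<^sup>i = d\<^sup>i\<close> pays for the excess \<open>i\<close> of the degree in \<open>c\<close>\<close>
  define V where "V = (\<Sum>i\<le>degree ?P. rescale d (m * N' + i) (P' i))"
  have "eval2 V x (of_nat d * c) = of_nat d ^ (m * N') * eval2 (multiplier_resultant d m) c x"
    if c: "norm c > radius d" for x c
  proof -
    have "eval2 V x (of_nat d * c) = (\<Sum>i\<le>degree ?P. of_nat d ^ (m * N' + i) * eval2 (P' i) x c)"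
      unfolding V_def eval2.hom_sum by (intro sum.cong refl eval2_rescale zero) auto
    also have "\<dots> = of_nat d ^ (m * N') * eval3 ?P c x (of_nat d)"
      by (simp add: eval3_eq_sum P' sum_distrib_left power_add mult_ac)
    also have "eval3 ?P c x (of_nat d) = eval2 (multiplier_resultant d m) c x"
      unfolding eval3_generic_resultant[OF d m c] eval2_multiplier_resultant[OF d m c] ..
    finally show ?thesis .
  qed
  then show ?thesis by blast
qed

text \<open>
  Clearing denominators in \<open>\<delta>(s / d, x)\<close> with a surplus factor \<open>d\<^sup>k\<close> gives \<open>a\<close> such that \<open>(d\<^sup>k)\<^sup>m\<close> divides \<open>a\<^sup>m\<close>,
  so the surplus divides \<open>a\<close>.
\<close>

lemma exists_rescaled_root:
  assumes d: "d \<ge> 1" and m: "m > 0"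
    and V: "\<And>x c. norm c > R \<Longrightarrow> eval2 V x (of_nat d * c) = of_nat d ^ (m * n) * eval2 \<delta> c x ^ m"
  shows "\<exists>E. \<forall>x c. eval2 E x (of_nat d * c) = of_nat d ^ n * eval2 \<delta> c x"
proof -
  obtain \<delta>' where \<delta>': "\<And>x c. eval2 \<delta>' x c = eval2 \<delta> c x" using exists_swap[of \<delta>] by blast
  define k where "k = degree \<delta>'"
  define a where "a = of_nat d ^ n * rescale d k \<delta>'"
  have a: "eval2 a x (of_nat d * c) = of_nat d ^ k * (of_nat d ^ n * eval2 \<delta> c x)" for x c
  proof -
    have "eval2 (rescale d k \<delta>') x (of_nat d * c) = of_nat d ^ k * eval2 \<delta>' x c"
      by (rule eval2_rescale) (simp add: k_def coeff_eq_0)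
    then show ?thesis by (simp add: a_def eval2.hom_mult eval2.hom_power eval2_of_nat \<delta>')
  qed
  have "a ^ m = (of_nat d ^ k) ^ m * V"
  proof (rule eval2_eqI'[of "real d * R"])
    fix x v :: complex assume v: "norm v > real d * R"
    define c where "c = v / of_nat d"
    have vc: "v = of_nat d * c" using d by (simp add: c_def)
    have "norm c > R" using v d by (simp add: vc norm_mult)
    then show "eval2 (a ^ m) x v = eval2 ((of_nat d ^ k) ^ m * V) x v"
      unfolding vc by (simp add: eval2.hom_mult eval2.hom_power eval2_of_nat a V power_mult_distrib
          power_mult[symmetric] mult.commute[of m])
  qed
  then have "(of_nat d ^ k) ^ m dvd a ^ m" by simp
  then have "of_nat d ^ k dvd a" using m by (simp only: pow_divides_pow_iff)
  then obtain E where E: "a = of_nat d ^ k * E" by blast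
  have "eval2 E x (of_nat d * c) = of_nat d ^ n * eval2 \<delta> c x" for x c
  proof -
    have "of_nat d ^ k * eval2 E x (of_nat d * c) = of_nat d ^ k * (of_nat d ^ n * eval2 \<delta> c x)"
      using a[of x c] by (simp add: E eval2.hom_mult eval2.hom_power eval2_of_nat)
    then show ?thesis using d by simp
  qed
  then show ?thesis by blast
qed

lemma eval2_subst_t:
  "eval2 (subst_t d Q) c x = poly (map_poly (spec x) Q) ((of_nat d * c) ^ d)"
proof (induction Q)
  case (pCons a Q)
  let ?t = "[:[:0, of_nat d:]:] ^ d :: int poly poly"
  have t: "eval2 ?t c x = (of_nat d * c) ^ d" by (simp add: eval2.hom_power mult.commute)
  have "subst_t d (pCons a Q) = map_poly (\<lambda>k. [:k:]) a + ?t * subst_t d Q"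
    unfolding subst_t_def by (subst Polynomial.map_poly_pCons) simp_all
  then have "eval2 (subst_t d (pCons a Q)) c x = spec x a + (of_nat d * c) ^ d * eval2 (subst_t d Q) c x"
    by (simp only: eval2.hom_add eval2.hom_mult eval2_embed_const t)
  then show ?case unfolding pCons.IH by (subst Polynomial.map_poly_pCons) simp_all
qed (simp add: subst_t_def)

section \<open>Leading coefficient\<close>

text \<open>
  A nonconstant polynomial has a complex root.
\<close>

lemma int_poly_unit_if_norm_1:
  assumes "\<And>x. norm (spec x l) = 1" shows "l = 1 \<or> l = - 1"
proof -
  have "constant (poly (of_int_poly l :: complex poly))"
    using fundamental_theorem_of_algebra[of "of_int_poly l"] assms unfolding spec_def by (metis norm_zero zero_neq_one)
  then have "degree l = 0" by (simp add: constant_degree)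
  then obtain a where a: "l = [:a:]" using degree_eq_zeroE by blast
  then have "\<bar>real_of_int a\<bar> = 1" using assms[of 0] by simp
  then have "\<bar>a\<bar> = 1" by linarith
  then show ?thesis using a by (auto simp: one_pCons)
qed

lemma poly_over_power_tendsto:
  fixes p :: "complex poly"
  assumes "degree p \<le> T"
  shows "((\<lambda>s :: real. poly p (of_real s) / of_real s ^ T) \<longlongrightarrow> coeff p T) at_top"
proof -
  have "((\<lambda>s :: real. complex_of_real (inverse s)) \<longlongrightarrow> of_real 0) at_top"
    by (intro tendsto_of_real tendsto_inverse_0_at_top filterlim_ident)
  then have "((\<lambda>s. \<Sum>j\<le>T. coeff p j * complex_of_real (inverse s) ^ (T - j))
      \<longlongrightarrow> (\<Sum>j\<le>T. coeff p j * of_real 0 ^ (T - j))) at_top"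
    by (intro tendsto_sum tendsto_mult tendsto_const tendsto_power)
  also have "(\<Sum>j\<le>T. coeff p j * of_real 0 ^ (T - j)) = (\<Sum>j\<le>T. if j = T then coeff p j else 0)"
    by (intro sum.cong) auto
  also have "\<dots> = coeff p T" by simp
  finally show ?thesis
  proof (rule Lim_transform_eventually)
    show "\<forall>\<^sub>F s in at_top. (\<Sum>j\<le>T. coeff p j * complex_of_real (inverse s) ^ (T - j))
        = poly p (of_real s) / of_real s ^ T"
      using eventually_gt_at_top[of 0]
    proof eventually_elim
      case (elim s)
      have "coeff p j * complex_of_real (inverse s) ^ (T - j) = coeff p j * of_real s ^ j / of_real s ^ T"
        if "j \<le> T" for j
      proof -
        have "complex_of_real s ^ T = of_real s ^ (T - j) * of_real s ^ j"
          using that by (simp add: power_add[symmetric])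
        then show ?thesis using elim by (simp add: field_simps)
      qed
      then show ?case unfolding poly_eq_sum_le[OF assms] by (simp add: sum_divide_distrib)
    qed
  qed
qed

lemma multiplier_resultant_bounds:
  assumes d: "d \<ge> 1" and m: "m > 0" and c: "norm c > near_radius d m"
    and N: "card (near c \<inter> primpts d c m) = N"
  defines "N' \<equiv> (d - 1) * (if m = 1 then 1 else 0) + N" and "K \<equiv> 4 * (real d + 1)"
    and "\<nu> \<equiv> degree (dynatomic d m)"
  shows "norm (eval2 (multiplier_resultant d m) c x)
      \<le> (1 + norm x / norm c) ^ \<nu> * ((norm c + K) ^ (m * N') * (real d * norm c + K) ^ (m * (d * N)))"
    and "norm c - K \<ge> 1 \<Longrightarrow> norm c - K \<ge> norm x \<Longrightarrow>
      (1 - norm x / (norm c - K)) ^ \<nu> * ((norm c - K) ^ (m * N') * (real d * norm c - K) ^ (m * (d * N)))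
      \<le> norm (eval2 (multiplier_resultant d m) c x)"
proof -
  have c': "norm c > radius d" using c radius_less_near_radius[of d m] by simp
  have c1: "norm c > 1" using c' by (simp add: radius_def)
  then have c0: "c \<noteq> 0" by auto
  have D: "norm (1 + of_nat d :: complex) \<le> real d + 1"
    using norm_triangle_ineq[of "1::complex" "of_nat d"] by simp
  have dc: "norm c \<le> real d * norm c" using d mult_right_mono[of 1 "real d" "norm c"] by simp
  have K0: "K \<ge> 0" by (simp add: K_def)
  note E = eval2_multiplier_resultant[OF d m c', of x]
  have "norm x \<le> norm x / norm c * norm c" using c0 by simp
  moreover have "norm c \<le> norm c + K" "norm c \<le> real d * norm c + K" using K0 dc by linarith+
  ultimately show "norm (eval2 (multiplier_resultant d m) c x)
      \<le> (1 + norm x / norm c) ^ \<nu> * ((norm c + K) ^ (m * N') * (real d * norm c + K) ^ (m * (d * N)))"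
    using multiplier_prod_upper[OF d m c D, of "norm c + K" "real d * norm c + K" "norm c" x "norm x / norm c"] c1
    unfolding E N N'_def \<nu>_def card_primpts[OF d m c'] by (simp add: K_def)
  assume M: "norm c - K \<ge> 1" "norm c - K \<ge> norm x"
  have "norm x \<le> norm x / (norm c - K) * (norm c - K)" "norm x / (norm c - K) \<le> 1" using M by auto
  moreover have "norm c - K \<le> real d * norm c - K" using dc by linarith
  ultimately show "(1 - norm x / (norm c - K)) ^ \<nu> * ((norm c - K) ^ (m * N') * (real d * norm c - K) ^ (m * (d * N)))
      \<le> norm (eval2 (multiplier_resultant d m) c x)"
    using multiplier_prod_lower[OF d m c D, of "norm c - K" "real d * norm c - K" "norm c - K" x "norm x / (norm c - K)"] M
    unfolding E N N'_def \<nu>_def card_primpts[OF d m c'] by (simp add: K_def)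
qed

text \<open>
  With \<open>u = 1 / |s|\<close>, both bounds for \<open>(|p(s)| / |s|\<^sup>T)\<^sup>m\<close> tend to 1. The exponents \<open>\<nu>\<close>, \<open>i\<close>, \<open>j\<close> belong to the
  influence of \<open>x\<close>, the factors near \<open>c\<close> and the factors near \<open>0\<close>.
\<close>

lemma top_coeff_norm_1:
  fixes p :: "complex poly" and a b y :: real
  assumes m: "m > 0" and nonneg: "a \<ge> 0" "b \<ge> 0" "y \<ge> 0"
    and upper: "\<And>s u. norm s > R \<Longrightarrow> u = inverse (norm s) \<Longrightarrow>
      norm (poly p s) ^ m \<le> (1 + y * u) ^ \<nu> * ((1 + a * u) ^ i * (1 + b * u) ^ j) * norm s ^ (m * T)"
    and lower: "\<And>s u. norm s > R \<Longrightarrow> u = inverse (norm s) \<Longrightarrow>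
      (1 - y * u / (1 - a * u)) ^ \<nu> * ((1 - a * u) ^ i * (1 - b * u) ^ j) * norm s ^ (m * T) \<le> norm (poly p s) ^ m"
  shows "degree p \<le> T" "norm (coeff p T) = 1"
proof -
  define U where "U u = (1 + y * u) ^ \<nu> * ((1 + a * u) ^ i * (1 + b * u) ^ j)" for u
  define L where "L u = (1 - y * u / (1 - a * u)) ^ \<nu> * ((1 - a * u) ^ i * (1 - b * u) ^ j)" for u
  have U1: "U 1 \<ge> 1"
  proof -
    have "1 * (1 * 1) \<le> U 1" unfolding U_def using nonneg by (intro mult_mono one_le_power) auto
    then show ?thesis by simp
  qed
  show deg: "degree p \<le> T"
  proof (rule degree_le_if_growth[of "max R 1"])
    fix s :: complex assume s: "norm s > max R 1"
    define u where "u = inverse (norm s)"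
    have "inverse (norm s) \<le> inverse 1" using s by (intro le_imp_inverse_le) auto
    then have u: "0 \<le> u" "u \<le> 1" using s by (auto simp: u_def)
    have mono: "0 \<le> 1 + k * u" "1 + k * u \<le> 1 + k * 1" if "k \<ge> 0" for k
      using u that mult_left_mono[of u 1 k] by auto
    have "U u \<le> U 1" unfolding U_def
      using mono[OF nonneg(1)] mono[OF nonneg(2)] mono[OF nonneg(3)]
      by (intro mult_mono power_mono mult_nonneg_nonneg zero_le_power) simp_all
    have "norm (poly p s) ^ m \<le> U u * norm s ^ (m * T)"
      using upper[of s u] s unfolding u_def U_def by simp
    also have "\<dots> \<le> U 1 * norm s ^ (m * T)" using \<open>U u \<le> U 1\<close> by (intro mult_right_mono) auto
    also have "\<dots> \<le> U 1 ^ m * norm s ^ (m * T)"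
      using power_increasing[of 1 m "U 1"] U1 m by (intro mult_right_mono) auto
    also have "\<dots> = (U 1 * norm s ^ T) ^ m"
      by (simp add: power_mult_distrib power_mult[symmetric] mult.commute)
    finally show "norm (poly p s) \<le> U 1 * norm s ^ T"
      using m U1 by (subst (asm) power_mono_iff) auto
  qed
  let ?f = "\<lambda>s :: real. norm (poly p (of_real s) / of_real s ^ T) ^ m"
  have lim: "(?f \<longlongrightarrow> norm (coeff p T) ^ m) at_top"
    by (intro tendsto_power tendsto_norm poly_over_power_tendsto deg)
  have inv: "((\<lambda>s :: real. inverse s) \<longlongrightarrow> 0) at_top"
    by (intro tendsto_inverse_0_at_top filterlim_ident)
  have "((\<lambda>s. U (inverse s)) \<longlongrightarrow> (1 + y * 0) ^ \<nu> * ((1 + a * 0) ^ i * (1 + b * 0) ^ j)) at_top"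
    unfolding U_def by (intro tendsto_intros inv)
  then have limU: "((\<lambda>s. U (inverse s)) \<longlongrightarrow> 1) at_top" by simp
  have "((\<lambda>s. L (inverse s)) \<longlongrightarrow> (1 - y * 0 / (1 - a * 0)) ^ \<nu> * ((1 - a * 0) ^ i * (1 - b * 0) ^ j)) at_top"
    unfolding L_def by (intro tendsto_intros inv) simp
  then have limL: "((\<lambda>s. L (inverse s)) \<longlongrightarrow> 1) at_top" by simp
  have f: "?f s = norm (poly p (of_real s)) ^ m / s ^ (m * T)" if "s > 0" for s
    using that by (simp add: norm_divide norm_power power_divide power_mult[symmetric] mult.commute)
  have "\<forall>\<^sub>F s in at_top. ?f s \<le> U (inverse s)"
    using eventually_gt_at_top[of "max R 0"]
  proof eventually_elim
    case (elim s)
    have "norm (poly p (of_real s)) ^ m \<le> U (inverse s) * s ^ (m * T)"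
      using upper[of "of_real s" "inverse s"] elim unfolding U_def by simp
    then show ?case using elim f by (simp add: divide_le_eq)
  qed
  then have "norm (coeff p T) ^ m \<le> 1" by (rule tendsto_le[OF _ limU lim, rotated]) simp
  moreover have "\<forall>\<^sub>F s in at_top. L (inverse s) \<le> ?f s"
    using eventually_gt_at_top[of "max R 0"]
  proof eventually_elim
    case (elim s)
    have "L (inverse s) * s ^ (m * T) \<le> norm (poly p (of_real s)) ^ m"
      using lower[of "of_real s" "inverse s"] elim unfolding L_def by simp
    then show ?case using elim f by (simp add: le_divide_eq)
  qed
  then have "1 \<le> norm (coeff p T) ^ m" by (rule tendsto_le[OF _ lim limL, rotated]) simp
  ultimately have "norm (coeff p T) ^ m = 1" by (rule antisym)
  then show "norm (coeff p T) = 1" using m power_eq_imp_eq_base[of "norm (coeff p T)" m 1] by simp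
qed

text \<open>
  In terms of \<open>s = dc\<close>, each of the \<open>m N'\<close> factors near \<open>c\<close> becomes \<open>d (c + O(1)) = s + O(1)\<close> with one of the
  \<open>m N'\<close> powers of \<open>d\<close>, and each factor near \<open>0\<close> is \<open>dc + O(1) = s + O(1)\<close> in modulus without any.
\<close>

lemma rescaled_multiplier_top_coeff:
  assumes d: "d \<ge> 1" and m: "m > 0"
    and N: "\<And>c. norm c > near_radius d m \<Longrightarrow> card (near c \<inter> primpts d c m) = N"
  defines "N' \<equiv> (d - 1) * (if m = 1 then 1 else 0) + N"
  assumes E: "\<And>x c. eval2 E x (of_nat d * c) = of_nat d ^ N' * eval2 (multiplier_poly d m) c x"
  shows "degree (map_poly (spec x) E) \<le> N' + d * N"
    "norm (coeff (map_poly (spec x) E) (N' + d * N)) = 1"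
proof -
  define K where "K = 4 * (real d + 1)"
  define \<nu> where "\<nu> = degree (dynatomic d m)"
  define R where "R = real d * (near_radius d m + K + 1 + norm x)"
  have d0: "real d > 0" using d by simp
  have K0: "K \<ge> 0" by (simp add: K_def)
  have near0: "near_radius d m \<ge> 0" by (simp add: near_radius_def radius_def)
  have E': "norm (poly (map_poly (spec x) E) s) ^ m
      = real d ^ (m * N') * norm (eval2 (multiplier_resultant d m) (s / of_nat d) x)" for s
  proof -
    have "poly (map_poly (spec x) E) s = of_nat d ^ N' * eval2 (multiplier_poly d m) (s / of_nat d) x"
      using E[of x "s / of_nat d"] d by (simp add: eval2_def)
    then have "poly (map_poly (spec x) E) s ^ m
        = of_nat d ^ (m * N') * eval2 (multiplier_resultant d m) (s / of_nat d) x"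
      unfolding multiplier_poly_spec(2)[OF d m, symmetric] eval2.hom_power
      by (simp add: power_mult_distrib power_mult[symmetric] mult.commute)
    then have "norm (poly (map_poly (spec x) E) s ^ m)
        = norm (of_nat d ^ (m * N') * eval2 (multiplier_resultant d m) (s / of_nat d) x)" by (simp only:)
    then show ?thesis by (simp add: norm_power norm_mult)
  qed
  have big: "norm (s / of_nat d) > near_radius d m" "norm (s / of_nat d) - K \<ge> 1"
    "norm (s / of_nat d) - K \<ge> norm x" "norm s > 0" "norm s - real d * K > 0" if s: "norm s > R" for s :: complex
  proof -
    have "norm s / real d > near_radius d m + K + 1 + norm x"
      using s d0 by (simp add: R_def less_divide_eq mult.commute)
    moreover have "norm (s / of_nat d) = norm s / real d" by (simp add: norm_divide)
    moreover have "norm s = real d * (norm s / real d)" using d0 by simp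
    ultimately show "norm (s / of_nat d) > near_radius d m" "norm (s / of_nat d) - K \<ge> 1"
      "norm (s / of_nat d) - K \<ge> norm x"
      using near0 K0 norm_ge_zero[of x] by linarith+
    then have "norm s / real d > K" by (simp add: norm_divide)
    then show "norm s - real d * K > 0" using d0 by (simp add: less_divide_eq mult.commute)
    then show "norm s > 0" using d0 K0 by (smt (verit) mult_nonneg_nonneg)
  qed
  have T: "m * (N' + d * N) = m * N' + m * (d * N)" by (simp add: distrib_left)
  have scale: "real d ^ k * (norm s / real d + e) ^ k = (1 + real d * e * inverse (norm s)) ^ k * norm s ^ k"
    if "norm s > 0" for s :: complex and e k
    using d0 that by (simp add: power_mult_distrib[symmetric] field_simps)
  have scale': "(real d * (norm s / real d) + e) ^ k = (1 + e * inverse (norm s)) ^ k * norm s ^ k"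
    if "norm s > 0" for s :: complex and e k
    using d0 that by (simp add: power_mult_distrib[symmetric] field_simps)
  let ?p = "map_poly (spec x) E"
  have bounds: "norm (poly ?p s) ^ m
      \<le> (1 + norm x * real d * u) ^ \<nu> * ((1 + real d * K * u) ^ (m * N') * (1 + K * u) ^ (m * (d * N)))
        * norm s ^ (m * (N' + d * N))" (is ?upper)
    "(1 - norm x * real d * u / (1 - real d * K * u)) ^ \<nu>
        * ((1 - real d * K * u) ^ (m * N') * (1 - K * u) ^ (m * (d * N)))
        * norm s ^ (m * (N' + d * N)) \<le> norm (poly ?p s) ^ m" (is ?lower)
    if s: "norm s > R" and u: "u = inverse (norm s)" for s u
  proof -
    note b = big[OF s]
    let ?c = "s / of_nat d"
    have nc: "norm ?c = norm s / real d" by (simp add: norm_divide)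
    have y: "1 + norm x / (norm s / real d) = 1 + norm x * real d * u"
      using u by (simp add: field_simps)
    have "norm (poly (map_poly (spec x) E) s) ^ m \<le> real d ^ (m * N') * ((1 + norm x / (norm s / real d)) ^ \<nu> *
        ((norm s / real d + K) ^ (m * N') * (real d * (norm s / real d) + K) ^ (m * (d * N))))"
      using multiplier_resultant_bounds(1)[OF d m b(1) N[OF b(1)], of x]
      unfolding E' nc N'_def \<nu>_def K_def by (intro mult_left_mono) auto
    also have "\<dots> = (1 + norm x / (norm s / real d)) ^ \<nu> *
        ((real d ^ (m * N') * (norm s / real d + K) ^ (m * N')) * (real d * (norm s / real d) + K) ^ (m * (d * N)))"
      by (simp only: mult_ac)
    also have "\<dots> = (1 + norm x * real d * u) ^ \<nu> * ((1 + real d * K * u) ^ (m * N') * (1 + K * u) ^ (m * (d * N)))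
        * norm s ^ (m * (N' + d * N))"
      unfolding y scale[OF b(4)] scale'[OF b(4)] T power_add u by (simp only: mult_ac)
    finally show ?upper .
    have y': "1 - norm x / (norm s / real d - K) = 1 - norm x * real d * u / (1 - real d * K * u)"
    proof -
      have "norm s / real d - K = (1 - real d * K * u) / (real d * u)"
        unfolding u using b(4) d0 by (simp add: field_simps)
      then show ?thesis by simp
    qed
    have "(1 - norm x * real d * u / (1 - real d * K * u)) ^ \<nu> * ((1 - real d * K * u) ^ (m * N') * (1 - K * u) ^ (m * (d * N)))
        * norm s ^ (m * (N' + d * N)) = (1 - norm x / (norm s / real d - K)) ^ \<nu> *
        ((real d ^ (m * N') * (norm s / real d + - K) ^ (m * N')) * (real d * (norm s / real d) + - K) ^ (m * (d * N)))"
      unfolding y' scale[OF b(4)] scale'[OF b(4)] T power_add u by (simp add: mult_ac)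
    also have "\<dots> = real d ^ (m * N') * ((1 - norm x / (norm s / real d - K)) ^ \<nu> *
        ((norm s / real d - K) ^ (m * N') * (real d * (norm s / real d) - K) ^ (m * (d * N))))"
      by (simp add: mult_ac)
    also have "\<dots> \<le> norm (poly (map_poly (spec x) E) s) ^ m"
      using multiplier_resultant_bounds(2)[OF d m b(1) N[OF b(1)], of x] b(2,3)
      unfolding E' nc N'_def \<nu>_def K_def by (intro mult_left_mono) auto
    finally show ?lower .
  qed
  show "degree ?p \<le> N' + d * N" "norm (coeff ?p (N' + d * N)) = 1"
    by (rule top_coeff_norm_1[OF m _ _ _ bounds]; use K0 in simp)+
qed

section \<open>Symmetry and conclusion\<close>

lemma exists_primitive_root_of_unity:
  assumes "d > 0" obtains \<zeta> :: complex where "\<zeta> ^ d = 1" "\<And>j. \<zeta> ^ j = 1 \<Longrightarrow> d dvd j"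
proof
  let ?r = "\<lambda>k. cis (2 * pi * real k / real d)"
  have bij: "bij_betw ?r {..<d} {z. z ^ d = 1}" by (rule bij_betw_roots_unity[OF assms])
  show one: "?r 1 ^ d = 1" using assms by (simp add: DeMoivre)
  show "d dvd j" if "?r 1 ^ j = 1" for j
  proof -
    have "?r 1 ^ (d * (j div d) + j mod d) = ?r 1 ^ (j mod d)"
      unfolding power_add power_mult one by simp
    then have "?r 1 ^ (j mod d) = 1" using that by simp
    moreover have "?r 1 ^ k = ?r k" for k by (simp add: DeMoivre mult_ac)
    ultimately have "?r (j mod d) = ?r 0" by simp
    then have "j mod d = 0"
      by (rule inj_onD[OF bij_betw_imp_inj_on[OF bij]]) (use assms in auto)
    then show ?thesis by auto
  qed
qed

text \<open>
  Rotation multiplies the coefficient of index \<open>j\<close> by \<open>\<zeta>\<^sup>j\<close>.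
\<close>

lemma coeff_zero_if_rotation_invariant:
  assumes "\<And>s. norm s > R \<Longrightarrow> poly p (\<zeta> * s) = poly p s" and "\<zeta> ^ j \<noteq> (1 :: complex)"
  shows "coeff p j = 0"
proof -
  have "pcompose p [:0, \<zeta>:] - p = 0"
    by (rule poly_eq_0_if_large_roots[of R]) (simp add: poly_pcompose assms(1) mult.commute[of _ \<zeta>])
  then have "coeff (pcompose p [:0, \<zeta>:]) j = coeff p j" by simp
  moreover have "coeff (pcompose p [:0, \<zeta>:]) j = \<zeta> ^ j * coeff p j" by (rule coeff_pcompose_linear)
  ultimately have "(\<zeta> ^ j - 1) * coeff p j = 0" by (simp add: left_diff_distrib)
  then show ?thesis using assms(2) by simp
qed

theorem theorem7p1:
  fixes d m :: nat
  assumes "d \<ge> 1" and "m \<ge> 1"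
  defines "\<epsilon> \<equiv> (if m = 1 then 1 else 0 :: nat)"
  shows "(d + 1) dvd degree (dynatomic d m) \<and>
    (\<exists>Q :: int poly poly.
       of_nat d ^ ((d - 1) * \<epsilon> + degree (dynatomic d m) div (d + 1)) * multiplier_poly d m
         = subst_t d Q \<and>
       (lead_coeff Q = 1 \<or> lead_coeff Q = - 1))"
proof -
  have d: "d \<ge> 1" and m: "m > 0" using assms by auto
  define N where "N = degree (dynatomic d m) div (d + 1)"
  define N' where "N' = (d - 1) * (if m = 1 then 1 else 0) + N"
  define T where "T = N' + d * N"
  have count: "(d + 1) * card (near c \<inter> primpts d c m) = degree (dynatomic d m)"
    if "norm c > near_radius d m" for c
    using card_near_primpts[OF d m that] card_primpts[OF d m] that radius_less_near_radius[of d m] by simp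
  then have N: "card (near c \<inter> primpts d c m) = N" if "norm c > near_radius d m" for c
    unfolding N_def using that by (metis nonzero_mult_div_cancel_left add_is_0 one_neq_zero)
  obtain c0 :: complex where "norm c0 > near_radius d m"
    using infinite_norm_gt[of "near_radius d m", THEN not_finite_existsD] by auto
  from count[OF this] have dvd: "(d + 1) dvd degree (dynatomic d m)" by (metis dvd_triv_left)
  obtain V where V: "\<And>x c. norm c > radius d \<Longrightarrow>
      eval2 V x (of_nat d * c) = of_nat d ^ (m * N') * eval2 (multiplier_resultant d m) c x"
    using exists_rescaled_resultant[OF d m N] unfolding N'_def by blast
  have "\<exists>E. \<forall>x c. eval2 E x (of_nat d * c) = of_nat d ^ N' * eval2 (multiplier_poly d m) c x"
    by (rule exists_rescaled_root[OF d m, of "radius d" V])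
      (simp add: V multiplier_poly_spec(2)[OF d m, symmetric] eval2.hom_power)
  then obtain E where E: "\<And>x c. eval2 E x (of_nat d * c) = of_nat d ^ N' * eval2 (multiplier_poly d m) c x"
    by blast
  note top = rescaled_multiplier_top_coeff[OF d m N E[unfolded N'_def], folded N'_def T_def]
  have high: "coeff E j = 0" if "j > T" for j
  proof (rule spec_eq_0[of 0])
    fix x :: complex
    have "coeff (map_poly (spec x) E) j = 0" using top(1)[of x] that by (intro coeff_eq_0) simp
    then show "spec x (coeff E j) = 0" by simp
  qed
  have unit: "coeff E T = 1 \<or> coeff E T = - 1"
    by (rule int_poly_unit_if_norm_1) (use top(2) in simp)
  obtain \<zeta> :: complex where \<zeta>: "\<zeta> ^ d = 1" "\<And>j. \<zeta> ^ j = 1 \<Longrightarrow> d dvd j"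
    using exists_primitive_root_of_unity[of d] d by auto
  have sparse: "coeff E j = 0" if j: "\<not> d dvd j" for j
  proof (rule spec_eq_0[of 0])
    fix x :: complex
    have "coeff (map_poly (spec x) E) j = 0"
    proof (rule coeff_zero_if_rotation_invariant[of "real d * radius d" _ \<zeta>])
      show "\<zeta> ^ j \<noteq> 1" using \<zeta>(2) j by blast
      fix s :: complex assume s: "norm s > real d * radius d"
      define c where "c = s / of_nat d"
      have sc: "s = of_nat d * c" using d by (simp add: c_def)
      have "norm c > radius d" using s d by (simp add: sc norm_mult)
      then have "eval2 E x (of_nat d * (\<zeta> * c)) = eval2 E x (of_nat d * c)"
        unfolding E by (simp add: multiplier_poly_rotate[OF d m \<zeta>(1)])
      then show "poly (map_poly (spec x) E) (\<zeta> * s) = poly (map_poly (spec x) E) s"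
        by (simp add: sc eval2_def mult_ac)
    qed
    then show "spec x (coeff E j) = 0" by simp
  qed
  have "coeff E T \<noteq> 0" using unit by auto
  then have "d dvd T" using sparse by blast
  then obtain n where n: "T = d * n" by blast
  define Q where "Q = (\<Sum>k\<le>n. monom (coeff E (d * k)) k)"
  have coeffQ: "coeff Q k = (if k \<le> n then coeff E (d * k) else 0)" for k
    by (simp add: Q_def coeff_sum)
  have "coeff Q n \<noteq> 0" using unit by (auto simp: coeffQ n)
  moreover have "degree Q \<le> n" by (rule degree_le) (simp add: coeffQ)
  ultimately have "degree Q = n" by (intro antisym le_degree)
  then have lead: "lead_coeff Q = 1 \<or> lead_coeff Q = - 1" using unit by (simp add: coeffQ n)
  have QE: "poly (map_poly (spec x) Q) (s ^ d) = eval2 E x s" for x s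
  proof -
    have "degree E \<le> T" by (rule degree_le) (simp add: high)
    then have "eval2 E x s = (\<Sum>j\<le>T. spec x (coeff E j) * s ^ j)" by (rule eval2_eq_sum_le)
    also have "\<dots> = (\<Sum>j\<in>(\<lambda>k. d * k) ` {..n}. spec x (coeff E j) * s ^ j)"
    proof (rule sum.mono_neutral_right)
      show "\<forall>j\<in>{..T} - (\<lambda>k. d * k) ` {..n}. spec x (coeff E j) * s ^ j = 0"
      proof
        fix j assume j: "j \<in> {..T} - (\<lambda>k. d * k) ` {..n}"
        have "\<not> d dvd j"
        proof
          assume "d dvd j"
          then obtain k where "j = d * k" by blast
          then show False using j d n by auto
        qed
        then show "spec x (coeff E j) * s ^ j = 0" using sparse by simp
      qed
    qed (use n in auto)
    also have "\<dots> = (\<Sum>k\<le>n. spec x (coeff E (d * k)) * (s ^ d) ^ k)"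
      using d by (subst sum.reindex) (auto simp: inj_on_def power_mult)
    also have "\<dots> = eval2 Q x (s ^ d)"
      unfolding eval2_eq_sum_le[OF \<open>degree Q \<le> n\<close>] by (intro sum.cong) (auto simp: coeffQ)
    finally show ?thesis by (simp add: eval2_def)
  qed
  have "of_nat d ^ N' * multiplier_poly d m = subst_t d Q"
    by (rule eval2_eqI[of 0]) (simp add: eval2_subst_t QE E eval2.hom_mult eval2.hom_power eval2_of_nat)
  then show ?thesis using dvd lead unfolding N'_def N_def \<epsilon>_def by blast
qed

end
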